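(* Let $L$ be the empirical loss functional of the mean-field one-hidden-layer network on $\mathcal P_2(\Theta)$. There exists a constant $C>0$ such that, along every gradient flow $(\mu_t)_{t\ge0}$ of $L$ with initial distribution $\mu\in\mathcal P_2(\Theta)$, for every $T>0$, $$\inf_\nu\Phi_T(\nu)\ \le\ \Phi_T(\mu_T)\ \le\ \inf_\nu\Phi_T(\nu)+C\,T\,r(T,\mu),$$ where $$\Phi_T(\nu):=L(\nu)+\frac1{2T}\mathcal W_2(\mu,\nu)^2,\qquad r(T,\mu):=\big[1+m_2(\mu)+T\,L(\mu)\big]^2 ,$$ $m_2(\mu)=\int_\Theta|\theta|^2\mu(\mathrm d\theta)$, and the infima are over $\nu\in\mathcal P_2(\Theta)$.
   Context: Parameter space $\Theta=\mathbb R\times\mathbb R^d\times\mathbb R$ with $\theta=(w,a,b)$; $\mathcal P_2(\Theta)$ is the set of probability measures on $\Theta$ with finite second moment, with the Wasserstein-2 metric $\mathcal W_2$. Given an activation $\sigma:\mathbb R\to\mathbb R$, a loss $\tilde L:\mathbb R\to\mathbb R_{\ge0}$ and data $(x_k,y_k)_{k=1}^M\subset\mathbb R^d\times\mathbb R$, set $$f_\mu(x)=\int_\Theta w\,\sigma(a\cdot x+b)\,\mu(\mathrm dw,\mathrm da,\mathrm db),\qquad L(\mu)=\frac1M\sum_{k=1}^M\tilde L(f_\mu(x_k)-y_k).$$ Standing assumptions: $\min_{\mathcal P_2(\Theta)}L=0$; and (i) there is $S_0\ge0$ with $|\sigma(z)-\sigma(z')|\le S_0|z-z'|$, $|\sigma(z)|\le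 S_0$, $|\sigma'(z)|\le S_0$ for all $z,z'\in\mathbb R$; (ii) $R:=\max_k\|x_k\|<\infty$; (iii) $\tilde L\in\mathcal C^1(\mathbb R)$ is convex and $|\tilde L'(r)-\tilde L'(s)|\le\beta|r-s|$ for all $r,s$, for some $\beta>0$; (iv) $\min_{\mathbb R}\tilde L=0$; (v) growth condition: there are constants $A_0,A_1$ with $L(\mu)\le A_0+A_1m_2(\mu)$ for all $\mu\in\mathcal P_2(\Theta)$. Upper gradient: $G(\mu)=\big(\int_\Theta\|\nabla_\theta\partial_\mu L(\mu)(\theta)\|^2\mu(\mathrm d\theta)\big)^{1/2}$, where $\partial_\mu L(\mu)(\theta)=\frac1M\sum_k\tilde L'(f_\mu(x_k)-y_k)\,w\,\sigma(a\cdot x_k+b)$ is the linear derivative; $G$ is a strong upper gradient of $L$: $|L(\mu_t)-L(\mu_s)|\le\int_s^tG(\mu_r)|\mu'|(r)\mathrm dr$ along absolutely continuous curves. Metric derivative: $|\mu'|(t)=\lim_{s\to t}\mathcal W_2(\mu_s,\mu_t)/|s-t|$. $AC^2_{loc}$: curves with, on each compact interval, $\mathcal W_2(\mu_s,\mu_t)\le\int_s^tm_u\mathrm du$ for some $m\in L^2$. A gradient flow of $L$ started at $\mu$ is a curve of maximal slope: $\boldsymbol\mu\in AC^2_{loc}([0,\infty);\mathcal P_2(\Theta))$, $\mu_0=\mu$, with $-\frac{\mathrm d}{\mathrm dt}L(\mu_t)=|\mu'|^2(t)=G^2(\mu_t)$ for a.e. $t>0$. *)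

theory Defs
  imports "HOL-Probability.Probability"
begin

definition P2 :: "'a::euclidean_space measure set" where
  "P2 = {\<mu>. prob_space \<mu> \<and> sets \<mu> = sets borel \<and> integrable \<mu> (\<lambda>\<theta>. (norm \<theta>)\<^sup>2)}"

definition m2 :: "'a::euclidean_space measure \<Rightarrow> real" where
  "m2 \<mu> = (\<integral>\<theta>. (norm \<theta>)\<^sup>2 \<partial>\<mu>)"

definition couplings ::
  "'a::euclidean_space measure \<Rightarrow> 'a measure \<Rightarrow> ('a \<times> 'a) measure set" where
  "couplings \<mu> \<nu> =
    {\<gamma>. sets \<gamma> = sets borel \<and> distr \<gamma> borel fst = \<mu> \<and> distr \<gamma> borel snd = \<nu>}"

text \<open>On \<^const>\<open>P2\<close> the infimum is finite (the product coupling has finite cost), so the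
  truncation of \<open>\<infinity>\<close> to \<open>0\<close> by \<^const>\<open>enn2real\<close> plays no role there.\<close>

definition W2 :: "'a::euclidean_space measure \<Rightarrow> 'a measure \<Rightarrow> real" where
  "W2 \<mu> \<nu> = sqrt (enn2real
     (INF \<gamma>\<in>couplings \<mu> \<nu>. \<integral>\<^sup>+(p, q). ennreal ((dist p q)\<^sup>2) \<partial>\<gamma>))"

definition AC2_loc :: "(real \<Rightarrow> 'a::euclidean_space measure) \<Rightarrow> bool" where
  "AC2_loc \<mu> \<longleftrightarrow> (\<forall>t\<ge>0. \<mu> t \<in> P2) \<and>
    (\<forall>a b. 0 \<le> a \<and> a \<le> b \<longrightarrow>
      (\<exists>m::real \<Rightarrow> real. set_borel_measurable lborel {a..b} m \<and>
         set_integrable lborel {a..b} (\<lambda>u. (m u)\<^sup>2) \<and>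
         (\<forall>s t. a \<le> s \<and> s \<le> t \<and> t \<le> b \<longrightarrow> W2 (\<mu> s) (\<mu> t) \<le> (LBINT u:{s..t}. m u))))"

text \<open>\<open>has_metric_derivative \<mu> v t\<close>: the limit defining \<open>|\<mu>'|(t)\<close> exists and equals \<open>v\<close>.\<close>

definition has_metric_derivative ::
  "(real \<Rightarrow> 'a::euclidean_space measure) \<Rightarrow> real \<Rightarrow> real \<Rightarrow> bool" where
  "has_metric_derivative \<mu> v t \<longleftrightarrow>
    ((\<lambda>s. W2 (\<mu> s) (\<mu> t) / \<bar>s - t\<bar>) \<longlongrightarrow> v) (at t)"

definition gradient :: "('a::real_inner \<Rightarrow> real) \<Rightarrow> 'a \<Rightarrow> 'a" where
  "gradient f z = (THE D. GDERIV f z :> D)"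

text \<open>A parameter is \<open>\<theta> = (w, a, b)\<close>; the norm of the product type is the Euclidean one.
  The data \<open>(x\<^sub>k, y\<^sub>k)\<close> are indexed by \<open>k = 1, \<dots>, M\<close>.\<close>

type_synonym 'd param = "real \<times> (real ^ 'd) \<times> real"

definition net :: "(real \<Rightarrow> real) \<Rightarrow> ('d::finite) param measure \<Rightarrow> real ^ 'd \<Rightarrow> real" where
  "net \<sigma> \<mu> x = (\<integral>(w, a, b). w * \<sigma> (a \<bullet> x + b) \<partial>\<mu>)"

definition loss ::
  "(real \<Rightarrow> real) \<Rightarrow> (real \<Rightarrow> real) \<Rightarrow> nat \<Rightarrow> (nat \<Rightarrow> real ^ 'd) \<Rightarrow> (nat \<Rightarrow> real) \<Rightarrow>
    ('d::finite) param measure \<Rightarrow> real" where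
  "loss \<sigma> Lt M x y \<mu> = 1 / real M * (\<Sum>k=1..M. Lt (net \<sigma> \<mu> (x k) - y k))"

definition linear_deriv ::
  "(real \<Rightarrow> real) \<Rightarrow> (real \<Rightarrow> real) \<Rightarrow> nat \<Rightarrow> (nat \<Rightarrow> real ^ 'd) \<Rightarrow> (nat \<Rightarrow> real) \<Rightarrow>
    ('d::finite) param measure \<Rightarrow> 'd param \<Rightarrow> real" where
  "linear_deriv \<sigma> Lt M x y \<mu> = (\<lambda>(w, a, b).
     1 / real M * (\<Sum>k=1..M. deriv Lt (net \<sigma> \<mu> (x k) - y k) * w * \<sigma> (a \<bullet> x k + b)))"

definition upper_gradient ::
  "(real \<Rightarrow> real) \<Rightarrow> (real \<Rightarrow> real) \<Rightarrow> nat \<Rightarrow> (nat \<Rightarrow> real ^ 'd) \<Rightarrow> (nat \<Rightarrow> real) \<Rightarrow>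
    ('d::finite) param measure \<Rightarrow> real" where
  "upper_gradient \<sigma> Lt M x y \<mu> =
    sqrt (\<integral>\<theta>. (norm (gradient (linear_deriv \<sigma> Lt M x y \<mu>) \<theta>))\<^sup>2 \<partial>\<mu>)"

text \<open>Curves of maximal slope. Only the restriction of \<open>\<mu>t\<close> to \<open>[0, \<infinity>)\<close> matters.\<close>

definition gradient_flow ::
  "(real \<Rightarrow> real) \<Rightarrow> (real \<Rightarrow> real) \<Rightarrow> nat \<Rightarrow> (nat \<Rightarrow> real ^ 'd) \<Rightarrow> (nat \<Rightarrow> real) \<Rightarrow>
    ('d::finite) param measure \<Rightarrow> (real \<Rightarrow> 'd param measure) \<Rightarrow> bool" where
  "gradient_flow \<sigma> Lt M x y \<mu> \<mu>t \<longleftrightarrow> AC2_loc \<mu>t \<and> \<mu>t 0 = \<mu> \<and>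
    (AE t in lborel. t > 0 \<longrightarrow>
      (\<exists>v. has_metric_derivative \<mu>t v t \<and>
           v\<^sup>2 = (upper_gradient \<sigma> Lt M x y (\<mu>t t))\<^sup>2 \<and>
           ((\<lambda>s. loss \<sigma> Lt M x y (\<mu>t s)) has_real_derivative - (v\<^sup>2)) (at t)))"

definition Phi ::
  "(real \<Rightarrow> real) \<Rightarrow> (real \<Rightarrow> real) \<Rightarrow> nat \<Rightarrow> (nat \<Rightarrow> real ^ 'd) \<Rightarrow> (nat \<Rightarrow> real) \<Rightarrow>
    ('d::finite) param measure \<Rightarrow> real \<Rightarrow> 'd param measure \<Rightarrow> real" where
  "Phi \<sigma> Lt M x y \<mu> T \<nu> = loss \<sigma> Lt M x y \<nu> + 1 / (2 * T) * (W2 \<mu> \<nu>)\<^sup>2"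

definition remainder ::
  "(real \<Rightarrow> real) \<Rightarrow> (real \<Rightarrow> real) \<Rightarrow> nat \<Rightarrow> (nat \<Rightarrow> real ^ 'd) \<Rightarrow> (nat \<Rightarrow> real) \<Rightarrow>
    real \<Rightarrow> ('d::finite) param measure \<Rightarrow> real" where
  "remainder \<sigma> Lt M x y T \<mu> = (1 + m2 \<mu> + T * loss \<sigma> Lt M x y \<mu>)\<^sup>2"

end

theory Submission
  imports Defs
begin

text \<open>
  Both inequalities compare \<open>\<Phi>\<^sub>T\<close> with the single number \<open>L(\<mu>)\<close>.

  \<^emph>\<open>From above.\<close> A curve of maximal slope satisfies
  \<open>L(\<mu>\<^sub>T) + W\<^sub>2(\<mu>, \<mu>\<^sub>T)\<^sup>2 / T \<le> L(\<mu>)\<close>, hence \<open>\<Phi>\<^sub>T(\<mu>\<^sub>T) \<le> L(\<mu>)\<close>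
  (\<open>maximal_slope_dissipation\<close>). Formally
  \<open>W\<^sub>2(\<mu>, \<mu>\<^sub>T)\<^sup>2 \<le> T \<integral> |\<mu>'|\<^sup>2 = T (L(\<mu>) - L(\<mu>\<^sub>T))\<close>. To avoid integrating the metric
  derivative, follow for a constant \<open>c\<close> the function
  \<open>H(t) = L(\<mu>\<^sub>t) + c W\<^sub>2(\<mu>, \<mu>\<^sub>t) - c\<^sup>2 t / 4\<close>: where the flow has metric speed \<open>v\<close> its growth
  rate is at most \<open>- v\<^sup>2 + c v - c\<^sup>2 / 4 = - (v - c / 2)\<^sup>2 \<le> 0\<close>. Since \<open>H\<close> is absolutely
  continuous it does not increase (\<open>AE_infinitesimally_nonincreasing_imp_le\<close>), and
  \<open>H(T) \<le> H(0)\<close> is the claim for \<open>c = 2 W\<^sub>2(\<mu>, \<mu>\<^sub>T) / T\<close>. This argument uses the triangle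
  inequality of \<open>W\<^sub>2\<close> (\<open>W2_triangle\<close>), which is obtained by gluing couplings along a fine
  countable partition instead of disintegrating them.

  \<^emph>\<open>From below.\<close> A remainder of order \<open>T\<close> only requires a first-order estimate. As \<open>L\<close> is a
  convex function of the linear quantities \<open>f\<^sub>\<mu>(x\<^sub>k)\<close>, and these are Lipschitz in \<open>W\<^sub>2\<close> with a
  constant that grows like the second moment's square root, the tangent inequality gives
  \<open>L(\<nu>) \<ge> L(\<mu>) - B (1 + \<surd>m\<^sub>2(\<mu>))\<^sup>2 W\<^sub>2(\<mu>, \<nu>)\<close> (\<open>loss_decrease_le_W2\<close>). Minimising
  \<open>- A W + W\<^sup>2 / (2 T)\<close> over \<open>W\<close> yields \<open>\<Phi>\<^sub>T(\<nu>) \<ge> L(\<mu>) - T A\<^sup>2 / 2\<close> with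
  \<open>A\<^sup>2 = B\<^sup>2 (1 + \<surd>m\<^sub>2(\<mu>))\<^sup>4 \<le> 4 B\<^sup>2 (1 + m\<^sub>2(\<mu>))\<^sup>2\<close>.

  The same first-order estimate, applied to two points of the flow, bounds the increments of \<open>L\<close>
  along it by a multiple of their distance, which is the absolute continuity that \<open>H\<close> needs.
\<close>

section \<open>Couplings and the Wasserstein distance\<close>

definition transport_cost :: "('a::euclidean_space \<times> 'a) measure \<Rightarrow> ennreal" where
  "transport_cost \<gamma> = (\<integral>\<^sup>+z. ennreal ((dist (fst z) (snd z))\<^sup>2) \<partial>\<gamma>)"

lemma W2_eq: "W2 \<mu> \<nu> = sqrt (enn2real (INF \<gamma>\<in>couplings \<mu> \<nu>. transport_cost \<gamma>))"
proof -
  have "(\<lambda>(p, q). ennreal ((dist p q)\<^sup>2)) = (\<lambda>z::'a \<times> 'a. ennreal ((dist (fst z) (snd z))\<^sup>2))"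
    by auto
  then show ?thesis unfolding W2_def transport_cost_def by simp
qed

lemma W2_nonneg: "0 \<le> W2 \<mu> \<nu>"
  by (simp add: W2_eq)

text \<open>
  The Borel sets of the product are presented as a product \<open>\<sigma>\<close>-algebra, the form in which
  the projections are recognised as measurable.
\<close>

lemma couplingsD:
  assumes "\<gamma> \<in> couplings \<mu> \<nu>"
  shows "sets \<gamma> = sets (borel \<Otimes>\<^sub>M borel)" "distr \<gamma> borel fst = \<mu>" "distr \<gamma> borel snd = \<nu>"
  using assms unfolding couplings_def borel_prod by blast+

lemma couplingsD_sets:
  assumes "\<gamma> \<in> couplings \<mu> \<nu>"
  shows "sets \<mu> = sets borel" "sets \<nu> = sets borel"
  using couplingsD(2,3)[OF assms] sets_distr by metis+

lemma P2D:
  assumes "\<mu> \<in> P2"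
  shows "prob_space \<mu>" "sets \<mu> = sets borel" "integrable \<mu> (\<lambda>\<theta>. (norm \<theta>)\<^sup>2)"
  using assms by (auto simp: P2_def)

lemma coupling_measurable:
  assumes "\<gamma> \<in> couplings \<mu> \<nu>"
  shows "fst \<in> measurable \<gamma> borel" "snd \<in> measurable \<gamma> borel"
  by (subst measurable_cong_sets[OF couplingsD(1)[OF assms] refl],
      rule measurable_fst measurable_snd)+

lemma nn_integral_coupling:
  fixes f :: "'a::euclidean_space \<Rightarrow> ennreal"
  assumes \<gamma>: "\<gamma> \<in> couplings \<mu> \<nu>" and f: "f \<in> borel_measurable borel"
  shows "(\<integral>\<^sup>+z. f (fst z) \<partial>\<gamma>) = (\<integral>\<^sup>+x. f x \<partial>\<mu>)"
    and "(\<integral>\<^sup>+z. f (snd z) \<partial>\<gamma>) = (\<integral>\<^sup>+x. f x \<partial>\<nu>)"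
proof -
  show "(\<integral>\<^sup>+z. f (fst z) \<partial>\<gamma>) = (\<integral>\<^sup>+x. f x \<partial>\<mu>)"
    using nn_integral_distr[OF coupling_measurable(1)[OF \<gamma>], of f] f
    unfolding couplingsD(2)[OF \<gamma>] measurable_cong_sets[OF couplingsD_sets(1)[OF \<gamma>] refl] by simp
  show "(\<integral>\<^sup>+z. f (snd z) \<partial>\<gamma>) = (\<integral>\<^sup>+x. f x \<partial>\<nu>)"
    using nn_integral_distr[OF coupling_measurable(2)[OF \<gamma>], of f] f
    unfolding couplingsD(3)[OF \<gamma>] measurable_cong_sets[OF couplingsD_sets(2)[OF \<gamma>] refl] by simp
qed

lemma coupling_prob_space:
  assumes "\<gamma> \<in> couplings \<mu> \<nu>" "\<mu> \<in> P2"
  shows "prob_space \<gamma>"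
  using prob_space_distrD[OF coupling_measurable(1)[OF assms(1)]]
    P2D(1)[OF assms(2)] couplingsD(2)[OF assms(1)] by simp

lemma nn_integral_norm_sq:
  assumes "\<mu> \<in> P2"
  shows "(\<integral>\<^sup>+x. ennreal ((norm x)\<^sup>2) \<partial>\<mu>) = ennreal (m2 \<mu>)"
  unfolding m2_def by (rule nn_integral_eq_integral[OF P2D(3)[OF assms]]) simp

lemma transport_cost_le:
  assumes \<gamma>: "\<gamma> \<in> couplings \<mu> \<nu>" and \<mu>: "\<mu> \<in> P2" and \<nu>: "\<nu> \<in> P2"
  shows "transport_cost \<gamma> \<le> ennreal (2 * m2 \<mu> + 2 * m2 \<nu>)"
proof -
  note [measurable_cong] = couplingsD(1)[OF \<gamma>]
  have m2: "0 \<le> m2 \<mu>" "0 \<le> m2 \<nu>" by (auto simp: m2_def)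
  have ineq: "(dist p q)\<^sup>2 \<le> 2 * (norm p)\<^sup>2 + 2 * (norm q)\<^sup>2" for p q :: 'a
  proof -
    have "(dist p q)\<^sup>2 \<le> (norm p + norm q)\<^sup>2"
      by (intro power_mono) (auto simp: dist_norm norm_triangle_ineq4)
    also have "\<dots> \<le> 2 * (norm p)\<^sup>2 + 2 * (norm q)\<^sup>2"
      using zero_le_power2[of "norm p - norm q"] by (simp add: power2_sum power2_diff)
    finally show ?thesis .
  qed
  have "transport_cost \<gamma> \<le> (\<integral>\<^sup>+z. 2 * ennreal ((norm (fst z))\<^sup>2) + 2 * ennreal ((norm (snd z))\<^sup>2) \<partial>\<gamma>)"
    unfolding transport_cost_def
  proof (rule nn_integral_mono)
    fix z :: "'a \<times> 'a"
    show "ennreal ((dist (fst z) (snd z))\<^sup>2) \<le> 2 * ennreal ((norm (fst z))\<^sup>2) + 2 * ennreal ((norm (snd z))\<^sup>2)"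
      using ennreal_leI[OF ineq[of "fst z" "snd z"]]
      by (simp add: ennreal_mult)
  qed
  also have "\<dots> = 2 * (\<integral>\<^sup>+z. ennreal ((norm (fst z))\<^sup>2) \<partial>\<gamma>) + 2 * (\<integral>\<^sup>+z. ennreal ((norm (snd z))\<^sup>2) \<partial>\<gamma>)"
    by (subst nn_integral_add) (auto simp: nn_integral_cmult)
  also have "\<dots> = 2 * ennreal (m2 \<mu>) + 2 * ennreal (m2 \<nu>)"
    using nn_integral_coupling[OF \<gamma>, of "\<lambda>x. ennreal ((norm x)\<^sup>2)"]
      nn_integral_norm_sq[OF \<mu>] nn_integral_norm_sq[OF \<nu>] by simp
  also have "\<dots> = ennreal (2 * m2 \<mu> + 2 * m2 \<nu>)"
    using m2 by (simp add: ennreal_mult)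
  finally show ?thesis .
qed

lemma product_coupling:
  fixes \<mu> \<nu> :: "'a::euclidean_space measure"
  assumes \<mu>: "\<mu> \<in> P2" and \<nu>: "\<nu> \<in> P2"
  shows "\<mu> \<Otimes>\<^sub>M \<nu> \<in> couplings \<mu> \<nu>"
proof -
  interpret M: prob_space \<mu> by (rule P2D(1)[OF \<mu>])
  interpret N: prob_space \<nu> by (rule P2D(1)[OF \<nu>])
  interpret pair_prob_space \<mu> \<nu> ..
  note [measurable_cong] = P2D(2)[OF \<mu>] P2D(2)[OF \<nu>]
  have s: "sets (\<mu> \<Otimes>\<^sub>M \<nu>) = sets borel"
    using P2D(2)[OF \<mu>] P2D(2)[OF \<nu>] by (simp add: borel_prod[symmetric] cong: sets_pair_measure_cong)
  have 1: "distr (\<mu> \<Otimes>\<^sub>M \<nu>) borel fst = \<mu>"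
    using N.distr_pair_fst[of \<mu>] distr_cong[of "\<mu> \<Otimes>\<^sub>M \<nu>" "\<mu> \<Otimes>\<^sub>M \<nu>" borel \<mu> fst fst] P2D(2)[OF \<mu>] by auto
  have "distr (\<mu> \<Otimes>\<^sub>M \<nu>) borel snd = distr (\<nu> \<Otimes>\<^sub>M \<mu>) borel fst"
    by (subst distr_pair_swap, subst distr_distr) (auto simp: comp_def case_prod_beta)
  also have "\<dots> = \<nu>"
    using M.distr_pair_fst[of \<nu>] distr_cong[of "\<nu> \<Otimes>\<^sub>M \<mu>" "\<nu> \<Otimes>\<^sub>M \<mu>" borel \<nu> fst fst] P2D(2)[OF \<nu>] by auto
  finally have 2: "distr (\<mu> \<Otimes>\<^sub>M \<nu>) borel snd = \<nu>" .
  from s 1 2 show ?thesis by (simp add: couplings_def)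
qed

lemma W2_le_coupling:
  assumes "\<gamma> \<in> couplings \<mu> \<nu>" "transport_cost \<gamma> \<le> ennreal (A\<^sup>2)" "0 \<le> A"
  shows "W2 \<mu> \<nu> \<le> A"
proof -
  have "(INF \<gamma>\<in>couplings \<mu> \<nu>. transport_cost \<gamma>) \<le> ennreal (A\<^sup>2)"
    using INF_lower[OF assms(1), of transport_cost] assms(2) by (rule order_trans)
  then have "enn2real (INF \<gamma>\<in>couplings \<mu> \<nu>. transport_cost \<gamma>) \<le> A\<^sup>2"
    by (rule enn2real_leI[rotated]) simp
  then show ?thesis
    unfolding W2_eq using assms(3) real_le_lsqrt by blast
qed

text \<open>
  This is where the finiteness of the infimum matters: the product coupling keeps
  \<^const>\<open>enn2real\<close> from collapsing \<open>\<infinity>\<close> to \<open>0\<close>. Optimal couplings exist, but near-optimal ones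
  are enough for every estimate below and need no compactness.
\<close>

lemma near_optimal_coupling:
  assumes \<mu>: "\<mu> \<in> P2" and \<nu>: "\<nu> \<in> P2" and A: "W2 \<mu> \<nu> < A"
  obtains \<gamma> where "\<gamma> \<in> couplings \<mu> \<nu>" "transport_cost \<gamma> \<le> ennreal (A\<^sup>2)"
proof -
  let ?I = "INF \<gamma>\<in>couplings \<mu> \<nu>. transport_cost \<gamma>"
  have "?I \<le> ennreal (2 * m2 \<mu> + 2 * m2 \<nu>)"
    using product_coupling[OF \<mu> \<nu>] transport_cost_le[OF _ \<mu> \<nu>] by (meson INF_lower2)
  then have fin: "?I < top"
    using ennreal_less_top le_less_trans by blast
  have "enn2real ?I < A\<^sup>2"
  proof -
    have "A = sqrt (A\<^sup>2)" using A W2_nonneg[of \<mu> \<nu>] by simp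
    then show ?thesis
      using A real_sqrt_less_iff[of "enn2real ?I" "A\<^sup>2"] unfolding W2_eq by metis
  qed
  then have "?I < ennreal (A\<^sup>2)"
    using fin by (metis enn2real_nonneg ennreal_enn2real ennreal_less_iff)
  then show ?thesis
    using that by (auto simp: INF_less_iff intro: less_imp_le)
qed

lemma borel_measurable_projections [measurable]:
  "fst \<in> measurable (borel :: ('a::second_countable_topology \<times> 'b::second_countable_topology) measure) borel"
  "snd \<in> measurable (borel :: ('a::second_countable_topology \<times> 'b::second_countable_topology) measure) borel"
  by (auto intro!: borel_measurable_continuous_onI continuous_intros)

lemma couplings_swap:
  assumes "\<gamma> \<in> couplings \<mu> \<nu>"
  shows "distr \<gamma> borel prod.swap \<in> couplings \<nu> \<mu>"
    and "transport_cost (distr \<gamma> borel prod.swap) = transport_cost \<gamma>"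
proof -
  note [measurable_cong] = couplingsD(1)[OF assms]
  have swap [measurable]: "prod.swap \<in> measurable \<gamma> borel"
    unfolding prod.swap_def[abs_def] by measurable
  show "distr \<gamma> borel prod.swap \<in> couplings \<nu> \<mu>"
    using couplingsD(2,3)[OF assms] distr_distr[OF borel_measurable_projections(1) swap]
      distr_distr[OF borel_measurable_projections(2) swap]
    by (simp add: couplings_def comp_def)
  show "transport_cost (distr \<gamma> borel prod.swap) = transport_cost \<gamma>"
    unfolding transport_cost_def
    by (subst nn_integral_distr) (auto simp: dist_commute)
qed

lemma W2_commute: "W2 \<mu> \<nu> = W2 \<nu> \<mu>"
proof -
  have "(INF \<gamma>\<in>couplings \<nu> \<mu>. transport_cost \<gamma>) \<le> (INF \<gamma>\<in>couplings \<mu> \<nu>. transport_cost \<gamma>)"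
    for \<mu> \<nu> :: "'a measure"
    by (rule INF_greatest) (metis INF_lower couplings_swap)
  then show ?thesis
    unfolding W2_eq by (metis antisym)
qed

section \<open>Gluing couplings and the triangle inequality\<close>

text \<open>
  Given \<open>u\<close> and \<open>v\<close> with the same law, this is the law of a pair that is drawn so that the two
  labels agree and that is conditionally independent given the label. As the labels are
  countable, the conditioning is an explicit density with respect to the product measure.
\<close>

definition cell_glue ::
  "'a measure \<Rightarrow> 'b measure \<Rightarrow> ('a \<Rightarrow> nat) \<Rightarrow> ('b \<Rightarrow> nat) \<Rightarrow> ('a \<times> 'b) measure" where
  "cell_glue M N u v = density (M \<Otimes>\<^sub>M N)
     (\<lambda>z. if u (fst z) = v (snd z)
          then ennreal (1 / measure M {p \<in> space M. u p = u (fst z)}) else 0)"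

lemma AE_cell_pos:
  fixes u :: "'a \<Rightarrow> nat"
  assumes "prob_space M" and [measurable]: "u \<in> measurable M (count_space UNIV)"
  shows "AE p in M. measure M {q \<in> space M. u q = u p} > 0"
proof -
  interpret prob_space M by fact
  have "AE p in M. \<forall>i. u p = i \<longrightarrow> measure M {q \<in> space M. u q = i} > 0"
    unfolding AE_all_countable
  proof
    fix i
    show "AE p in M. u p = i \<longrightarrow> measure M {q \<in> space M. u q = i} > 0"
    proof (cases "measure M {q \<in> space M. u q = i} > 0")
      case False
      then have "measure M {q \<in> space M. u q = i} = 0"
        using measure_nonneg[of M "{q \<in> space M. u q = i}"] by linarith
      then have "AE p in M. u p \<noteq> i"
        by (subst (asm) prob_eq_0) auto
      then show ?thesis by eventually_elim simp
    qed auto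
  qed
  then show ?thesis by auto
qed

lemma measurable_cell_density:
  fixes u :: "'a \<Rightarrow> nat" and v :: "'b \<Rightarrow> nat" and c :: "nat \<Rightarrow> real"
  assumes [measurable]: "u \<in> measurable M (count_space UNIV)" "v \<in> measurable N (count_space UNIV)"
  shows "(\<lambda>z. if u (fst z) = v (snd z) then ennreal (1 / c (u (fst z))) else 0)
    \<in> borel_measurable (M \<Otimes>\<^sub>M N)"
proof -
  have "Measurable.pred (M \<Otimes>\<^sub>M N) (\<lambda>z. \<exists>i. u (fst z) = i \<and> v (snd z) = i)"
    by measurable
  then have [measurable]: "Measurable.pred (M \<Otimes>\<^sub>M N) (\<lambda>z. u (fst z) = v (snd z))"
    by (simp add: eq_commute)
  have [measurable]: "c \<in> measurable (count_space UNIV) borel" by simp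
  show ?thesis by measurable
qed

text \<open>
  Given \<open>p\<close>, the density in \<open>q\<close> is \<open>1 / c\<close> on the cell \<open>v q = u p\<close>, whose mass is \<open>c\<close> because \<open>u\<close>
  and \<open>v\<close> have the same law; so it integrates to 1. Cells of mass zero form a null set, being
  countably many.
\<close>

lemma nn_integral_cell_glue:
  fixes u :: "'a \<Rightarrow> nat" and v :: "'b \<Rightarrow> nat"
  assumes M: "prob_space M" and N: "prob_space N"
    and u[measurable]: "u \<in> measurable M (count_space UNIV)"
    and v[measurable]: "v \<in> measurable N (count_space UNIV)"
    and law: "\<And>i. measure M {p \<in> space M. u p = i} = measure N {q \<in> space N. v q = i}"
  shows nn_integral_cell_glue_fst: "\<And>f. f \<in> borel_measurable M \<Longrightarrow>
        (\<integral>\<^sup>+z. f (fst z) \<partial>cell_glue M N u v) = (\<integral>\<^sup>+p. f p \<partial>M)"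
    and nn_integral_cell_glue_snd: "\<And>g. g \<in> borel_measurable N \<Longrightarrow>
        (\<integral>\<^sup>+z. g (snd z) \<partial>cell_glue M N u v) = (\<integral>\<^sup>+q. g q \<partial>N)"
proof -
  interpret M: prob_space M by fact
  interpret N: prob_space N by fact
  interpret pair_prob_space M N ..
  define c where "c i = measure M {p \<in> space M. u p = i}" for i
  define h where "h z = (if u (fst z) = v (snd z) then ennreal (1 / c (u (fst z))) else 0)" for z
  have glue: "cell_glue M N u v = density (M \<Otimes>\<^sub>M N) h"
    unfolding cell_glue_def c_def h_def ..
  have [measurable]: "h \<in> borel_measurable (M \<Otimes>\<^sub>M N)"
    unfolding h_def[abs_def] by (rule measurable_cell_density[OF u v])
  have one: "ennreal (1 / r) * ennreal r = 1" if "r > 0" for r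
    using that by (simp add: ennreal_mult[symmetric])
  have cell_N: "(\<integral>\<^sup>+q. h (p, q) \<partial>N) = 1" if "c (u p) > 0" for p
  proof -
    have "(\<integral>\<^sup>+q. h (p, q) \<partial>N)
      = (\<integral>\<^sup>+q. ennreal (1 / c (u p)) * indicator {q \<in> space N. v q = u p} q \<partial>N)"
      by (intro nn_integral_cong) (auto simp: h_def split: split_indicator)
    also have "\<dots> = ennreal (1 / c (u p)) * ennreal (c (u p))"
      by (subst nn_integral_cmult_indicator) (auto simp: N.emeasure_eq_measure law c_def)
    finally show ?thesis using one[OF that] by simp
  qed
  have cell_M: "(\<integral>\<^sup>+p. h (p, q) \<partial>M) = 1" if "c (v q) > 0" for q
  proof -
    have "(\<integral>\<^sup>+p. h (p, q) \<partial>M)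
      = (\<integral>\<^sup>+p. ennreal (1 / c (v q)) * indicator {p \<in> space M. u p = v q} p \<partial>M)"
      by (intro nn_integral_cong) (auto simp: h_def split: split_indicator)
    also have "\<dots> = ennreal (1 / c (v q)) * ennreal (c (v q))"
      by (subst nn_integral_cmult_indicator) (auto simp: M.emeasure_eq_measure c_def)
    finally show ?thesis using one[OF that] by simp
  qed
  have pos_M: "AE p in M. c (u p) > 0" and pos_N: "AE q in N. c (v q) > 0"
    using AE_cell_pos[OF M u] AE_cell_pos[OF N v] by (simp_all add: c_def law)
  show "(\<integral>\<^sup>+z. f (fst z) \<partial>cell_glue M N u v) = (\<integral>\<^sup>+p. f p \<partial>M)"
    if [measurable]: "f \<in> borel_measurable M" for f
  proof -
    have "(\<integral>\<^sup>+z. f (fst z) \<partial>cell_glue M N u v)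
      = (\<integral>\<^sup>+z. h z * f (fst z) \<partial>(M \<Otimes>\<^sub>M N))"
      unfolding glue by (subst nn_integral_density) auto
    also have "\<dots> = (\<integral>\<^sup>+p. \<integral>\<^sup>+q. h (p, q) * f p \<partial>N \<partial>M)"
      by (subst N.nn_integral_fst[symmetric]) auto
    also have "\<dots> = (\<integral>\<^sup>+p. (\<integral>\<^sup>+q. h (p, q) \<partial>N) * f p \<partial>M)"
      by (intro nn_integral_cong nn_integral_multc) auto
    also have "\<dots> = (\<integral>\<^sup>+p. f p \<partial>M)"
      using pos_M by (intro nn_integral_cong_AE, eventually_elim) (simp add: cell_N)
    finally show ?thesis .
  qed
  show "(\<integral>\<^sup>+z. g (snd z) \<partial>cell_glue M N u v) = (\<integral>\<^sup>+q. g q \<partial>N)"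
    if [measurable]: "g \<in> borel_measurable N" for g
  proof -
    have "(\<integral>\<^sup>+z. g (snd z) \<partial>cell_glue M N u v)
      = (\<integral>\<^sup>+z. h z * g (snd z) \<partial>(M \<Otimes>\<^sub>M N))"
      unfolding glue by (subst nn_integral_density) auto
    also have "\<dots> = (\<integral>\<^sup>+q. \<integral>\<^sup>+p. h (p, q) * g q \<partial>M \<partial>N)"
      by (subst nn_integral_snd[symmetric]) auto
    also have "\<dots> = (\<integral>\<^sup>+q. (\<integral>\<^sup>+p. h (p, q) \<partial>M) * g q \<partial>N)"
      by (intro nn_integral_cong nn_integral_multc) auto
    also have "\<dots> = (\<integral>\<^sup>+q. g q \<partial>N)"
      using pos_N by (intro nn_integral_cong_AE, eventually_elim) (simp add: cell_M)
    finally show ?thesis .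
  qed
qed

lemma AE_cell_glue:
  fixes u :: "'a \<Rightarrow> nat" and v :: "'b \<Rightarrow> nat"
  assumes "u \<in> measurable M (count_space UNIV)" "v \<in> measurable N (count_space UNIV)"
  shows "AE z in cell_glue M N u v. u (fst z) = v (snd z)"
  unfolding cell_glue_def
  by (subst AE_density[OF measurable_cell_density[OF assms, of "\<lambda>i. measure M {p \<in> space M. u p = i}"]])
    auto

text \<open>
  Label a point by the first member of a dense sequence that comes within \<open>e / 2\<close> of it.
\<close>

lemma fine_cells:
  fixes e :: real
  assumes "e > 0"
  obtains c :: "'a::euclidean_space \<Rightarrow> nat"
  where "c \<in> measurable borel (count_space UNIV)" "\<And>p q. c p = c q \<Longrightarrow> dist p q \<le> e"
proof -
  obtain D :: "'a set" where D: "countable D" "\<And>X. open X \<Longrightarrow> X \<noteq> {} \<Longrightarrow> \<exists>d\<in>D. d \<in> X"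
    by (erule countable_dense_setE)
  have "D \<noteq> {}" using D(2)[of UNIV] by auto
  define d where "d = from_nat_into D"
  have ex: "\<exists>n. dist (d n) p < e / 2" for p
  proof -
    obtain x where "x \<in> D" "x \<in> ball p (e / 2)"
      using D(2)[of "ball p (e / 2)"] assms by auto
    then show ?thesis
      using from_nat_into_surj[OF D(1)] by (force simp: d_def dist_commute)
  qed
  define c where "c p = (LEAST n. dist (d n) p < e / 2)" for p
  have c: "dist (d (c p)) p < e / 2" for p
    unfolding c_def using ex by (rule LeastI_ex)
  show ?thesis
  proof (rule that)
    show "c \<in> measurable borel (count_space UNIV)"
      unfolding c_def[abs_def] by measurable
    show "dist p q \<le> e" if "c p = c q" for p q
      using c[of p] c[of q] that dist_triangle2[of p q "d (c p)"]
      by (simp add: dist_commute)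
  qed
qed

text \<open>
  A weighted Cauchy-Schwarz inequality. Applied pointwise and integrated, with \<open>A\<close>, \<open>B\<close>, \<open>C\<close>
  bounds for the \<open>L\<^sup>2\<close> norms of \<open>a\<close>, \<open>b\<close>, \<open>c\<close>, it gives Minkowski's inequality.
\<close>

lemma sum3_sq_le:
  fixes a b c A B C :: real
  assumes "A > 0" "B > 0" "C > 0"
  shows "(a + b + c)\<^sup>2 \<le> (A + B + C) * (a\<^sup>2 / A + b\<^sup>2 / B + c\<^sup>2 / C)"
proof -
  have "(A + B + C) * (a\<^sup>2 / A + b\<^sup>2 / B + c\<^sup>2 / C) - (a + b + c)\<^sup>2
    = (a * B - b * A)\<^sup>2 / (A * B) + (a * C - c * A)\<^sup>2 / (A * C) + (b * C - c * B)\<^sup>2 / (B * C)"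
    using assms by (simp add: field_simps power2_eq_square)
  also have "\<dots> \<ge> 0" using assms by auto
  finally show ?thesis by simp
qed

text \<open>
  Take couplings \<open>\<gamma>\<close> of \<open>\<mu>, \<nu>\<close> and \<open>\<eta>\<close> of \<open>\<nu>, \<rho>\<close> and glue them along the cells of a partition of
  diameter \<open>e\<close>. A glued quadruple \<open>((x, y), (y', z))\<close> has \<open>y\<close> and \<open>y'\<close> in the same cell but not
  necessarily equal, so \<open>(x, z)\<close> couples \<open>\<mu>\<close> and \<open>\<rho>\<close> exactly and the mismatch in the middle costs at most \<open>e\<close>.
\<close>

lemma W2_triangle:
  fixes \<mu> \<nu> \<rho> :: "'a::euclidean_space measure"
  assumes \<mu>: "\<mu> \<in> P2" and \<nu>: "\<nu> \<in> P2" and \<rho>: "\<rho> \<in> P2"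
  shows "W2 \<mu> \<rho> \<le> W2 \<mu> \<nu> + W2 \<nu> \<rho>"
proof (rule field_le_epsilon)
  fix e' :: real assume "e' > 0"
  define e where "e = e' / 3"
  define A where "A = W2 \<mu> \<nu> + e"
  define B where "B = W2 \<nu> \<rho> + e"
  have e: "e > 0" and A: "A > 0" and B: "B > 0"
    using \<open>e' > 0\<close> W2_nonneg[of \<mu> \<nu>] W2_nonneg[of \<nu> \<rho>] by (auto simp: e_def A_def B_def)
  obtain \<gamma> where \<gamma>: "\<gamma> \<in> couplings \<mu> \<nu>" "transport_cost \<gamma> \<le> ennreal (A\<^sup>2)"
    using near_optimal_coupling[OF \<mu> \<nu>, of A] e by (auto simp: A_def)
  obtain \<eta> where \<eta>: "\<eta> \<in> couplings \<nu> \<rho>" "transport_cost \<eta> \<le> ennreal (B\<^sup>2)"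
    using near_optimal_coupling[OF \<nu> \<rho>, of B] e by (auto simp: B_def)
  note [measurable_cong] = couplingsD(1)[OF \<gamma>(1)] couplingsD(1)[OF \<eta>(1)]
  obtain c :: "'a \<Rightarrow> nat" where c[measurable]: "c \<in> measurable borel (count_space UNIV)"
    and c_dist: "\<And>p q. c p = c q \<Longrightarrow> dist p q \<le> e"
    using fine_cells[OF e] by blast
  define u v where "u z = c (snd z)" and "v z = c (fst z)" for z :: "'a \<times> 'a"
  have u[measurable]: "u \<in> measurable \<gamma> (count_space UNIV)"
    and v[measurable]: "v \<in> measurable \<eta> (count_space UNIV)"
    unfolding u_def[abs_def] v_def[abs_def] by measurable
  \<comment> \<open>both are the law of the cell of a point drawn from \<open>\<nu>\<close>\<close>
  have law: "measure \<gamma> {p \<in> space \<gamma>. u p = i} = measure \<eta> {q \<in> space \<eta>. v q = i}" for i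
  proof -
    have "measure \<gamma> {p \<in> space \<gamma>. u p = i} = measure (distr \<gamma> borel snd) {y. c y = i}"
      by (subst measure_distr) (auto simp: u_def intro!: arg_cong2[where f=measure])
    also have "\<dots> = measure (distr \<eta> borel fst) {y. c y = i}"
      using couplingsD[OF \<gamma>(1)] couplingsD[OF \<eta>(1)] by simp
    also have "\<dots> = measure \<eta> {q \<in> space \<eta>. v q = i}"
      by (subst measure_distr) (auto simp: v_def intro!: arg_cong2[where f=measure])
    finally show ?thesis .
  qed
  define G where "G = cell_glue \<gamma> \<eta> u v"
  have [measurable_cong]: "sets G = sets (\<gamma> \<Otimes>\<^sub>M \<eta>)"
    by (simp add: G_def cell_glue_def)
  note glue = nn_integral_cell_glue[OF coupling_prob_space[OF \<gamma>(1) \<mu>] coupling_prob_space[OF \<eta>(1) \<nu>] u v law,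
      folded G_def]
  let ?P = "\<lambda>z::('a \<times> 'a) \<times> ('a \<times> 'a). (fst (fst z), snd (snd z))"
  define \<pi> where "\<pi> = distr G borel ?P"
  have \<pi>: "\<pi> \<in> couplings \<mu> \<rho>"
  proof -
    have "distr \<pi> borel fst = \<mu>"
    proof (rule measure_eqI)
      show "sets (distr \<pi> borel fst) = sets \<mu>" using P2D(2)[OF \<mu>] by simp
      fix S assume "S \<in> sets (distr \<pi> borel fst)"
      then have [measurable]: "S \<in> sets borel" by simp
      have "emeasure (distr \<pi> borel fst) S = (\<integral>\<^sup>+x. indicator S x \<partial>distr \<pi> borel fst)"
        by (subst nn_integral_indicator) auto
      also have "\<dots> = (\<integral>\<^sup>+z. indicator S (fst (fst z)) \<partial>G)"
        unfolding \<pi>_def by (simp add: nn_integral_distr del: nn_integral_indicator)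
      also have "\<dots> = (\<integral>\<^sup>+z. indicator S (fst z) \<partial>\<gamma>)"
        by (rule glue(1)) measurable
      also have "\<dots> = (\<integral>\<^sup>+x. indicator S x \<partial>\<mu>)"
        by (rule nn_integral_coupling(1)[OF \<gamma>(1)]) measurable
      also have "\<dots> = emeasure \<mu> S"
        using P2D(2)[OF \<mu>] by (subst nn_integral_indicator) auto
      finally show "emeasure (distr \<pi> borel fst) S = emeasure \<mu> S" .
    qed
    moreover have "distr \<pi> borel snd = \<rho>"
    proof (rule measure_eqI)
      show "sets (distr \<pi> borel snd) = sets \<rho>" using P2D(2)[OF \<rho>] by simp
      fix S assume "S \<in> sets (distr \<pi> borel snd)"
      then have [measurable]: "S \<in> sets borel" by simp
      have "emeasure (distr \<pi> borel snd) S = (\<integral>\<^sup>+x. indicator S x \<partial>distr \<pi> borel snd)"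
        by (subst nn_integral_indicator) auto
      also have "\<dots> = (\<integral>\<^sup>+z. indicator S (snd (snd z)) \<partial>G)"
        unfolding \<pi>_def by (simp add: nn_integral_distr del: nn_integral_indicator)
      also have "\<dots> = (\<integral>\<^sup>+z. indicator S (snd z) \<partial>\<eta>)"
        by (rule glue(2)) measurable
      also have "\<dots> = (\<integral>\<^sup>+x. indicator S x \<partial>\<rho>)"
        by (rule nn_integral_coupling(2)[OF \<eta>(1)]) measurable
      also have "\<dots> = emeasure \<rho> S"
        using P2D(2)[OF \<rho>] by (subst nn_integral_indicator) auto
      finally show "emeasure (distr \<pi> borel snd) S = emeasure \<rho> S" .
    qed
    ultimately show ?thesis by (simp add: couplings_def \<pi>_def)
  qed
  have G1: "emeasure G (space G) = 1"
    using glue(1)[of "\<lambda>_. 1"] prob_space.emeasure_space_1[OF coupling_prob_space[OF \<gamma>(1) \<mu>]] by simp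
  let ?S = "A + e + B"
  let ?d = "\<lambda>z. (dist (fst z) (snd z))\<^sup>2"
  have ennreal_split: "ennreal (p * a + r + q * b) = ennreal p * ennreal a + ennreal r + ennreal q * ennreal b"
    if "0 \<le> p" "0 \<le> a" "0 \<le> r" "0 \<le> q" "0 \<le> b" for p q r a b :: real
    using that by (simp add: ennreal_mult)
  have coeffs: "0 \<le> ?S / A" "0 \<le> ?S * e" "0 \<le> ?S / B"
    using A B e by auto
  have bound: "AE z in G. ennreal (?d (?P z))
      \<le> ennreal (?S / A) * ennreal (?d (fst z)) + ennreal (?S * e) + ennreal (?S / B) * ennreal (?d (snd z))"
    using AE_cell_glue[OF u v, folded G_def]
  proof eventually_elim
    fix z assume "u (fst z) = v (snd z)"
    then have mid: "dist (snd (fst z)) (fst (snd z)) \<le> e"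
      using c_dist by (simp add: u_def v_def)
    have "dist (fst (fst z)) (snd (snd z)) \<le> dist (fst (fst z)) (snd (fst z)) + e + dist (fst (snd z)) (snd (snd z))"
      using dist_triangle[of "fst (fst z)" "snd (snd z)" "snd (fst z)"]
        dist_triangle[of "snd (fst z)" "snd (snd z)" "fst (snd z)"] mid by linarith
    then have "?d (?P z) \<le> (dist (fst (fst z)) (snd (fst z)) + e + dist (fst (snd z)) (snd (snd z)))\<^sup>2"
      by (simp add: power_mono)
    also have "\<dots> \<le> ?S * (?d (fst z) / A + e\<^sup>2 / e + ?d (snd z) / B)"
      using sum3_sq_le[OF A e B] by simp
    also have "\<dots> = ?S / A * ?d (fst z) + ?S * e + ?S / B * ?d (snd z)"
      using e by (simp add: field_simps power2_eq_square)
    finally have "ennreal (?d (?P z)) \<le> ennreal (?S / A * ?d (fst z) + ?S * e + ?S / B * ?d (snd z))"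
      by (rule ennreal_leI)
    also have "\<dots> = ennreal (?S / A) * ennreal (?d (fst z)) + ennreal (?S * e)
        + ennreal (?S / B) * ennreal (?d (snd z))"
      by (rule ennreal_split) (use coeffs in auto)
    finally show "ennreal (?d (?P z))
      \<le> ennreal (?S / A) * ennreal (?d (fst z)) + ennreal (?S * e) + ennreal (?S / B) * ennreal (?d (snd z))" .
  qed
  have "transport_cost \<pi> = (\<integral>\<^sup>+z. ennreal (?d (?P z)) \<partial>G)"
    unfolding transport_cost_def \<pi>_def by (subst nn_integral_distr) auto
  also have "\<dots> \<le> (\<integral>\<^sup>+z. ennreal (?S / A) * ennreal (?d (fst z)) + ennreal (?S * e)
      + ennreal (?S / B) * ennreal (?d (snd z)) \<partial>G)"
    using bound by (rule nn_integral_mono_AE)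
  also have "\<dots> = ennreal (?S / A) * (\<integral>\<^sup>+z. ennreal (?d (fst z)) \<partial>G) + ennreal (?S * e)
      + ennreal (?S / B) * (\<integral>\<^sup>+z. ennreal (?d (snd z)) \<partial>G)"
    by (simp add: nn_integral_add nn_integral_cmult G1)
  also have "\<dots> = ennreal (?S / A) * transport_cost \<gamma> + ennreal (?S * e)
      + ennreal (?S / B) * transport_cost \<eta>"
    using glue(1)[of "\<lambda>p. ennreal (?d p)"] glue(2)[of "\<lambda>p. ennreal (?d p)"]
    by (simp add: transport_cost_def)
  also have "\<dots> \<le> ennreal (?S / A) * ennreal (A\<^sup>2) + ennreal (?S * e)
      + ennreal (?S / B) * ennreal (B\<^sup>2)"
    using \<gamma>(2) \<eta>(2) by (intro add_mono mult_left_mono) auto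
  also have "\<dots> = ennreal (?S / A * A\<^sup>2 + ?S * e + ?S / B * B\<^sup>2)"
    by (rule ennreal_split[symmetric]) (use coeffs in auto)
  also have "?S / A * A\<^sup>2 + ?S * e + ?S / B * B\<^sup>2 = ?S\<^sup>2"
    using A B by (simp add: field_simps power2_eq_square)
  finally have "transport_cost \<pi> \<le> ennreal (?S\<^sup>2)" .
  then have "W2 \<mu> \<rho> \<le> ?S"
    using W2_le_coupling[OF \<pi>] A B e by simp
  then show "W2 \<mu> \<rho> \<le> W2 \<mu> \<nu> + W2 \<nu> \<rho> + e'"
    by (simp add: A_def B_def e_def)
qed

section \<open>Absolutely continuous functions with nonpositive growth rate\<close>

lemma null_set_small_open_superset:
  fixes M :: "real measure"
  assumes fin: "finite_measure M" and M: "sets M = sets borel"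
    and ae: "AE x in M. P x" and e: "e > (0::real)"
  obtains U where "open U" "measure M U < e" "\<And>x. x \<notin> U \<Longrightarrow> P x"
proof -
  interpret finite_measure M by fact
  obtain N where N: "{x \<in> space M. \<not> P x} \<subseteq> N" "emeasure M N = 0" "N \<in> sets M"
    using ae by (erule AE_E)
  have "(INF U \<in> {U. N \<subseteq> U \<and> open U}. emeasure M U) = 0"
    using outer_regular[of M N] M N emeasure_finite by simp
  then have "(INF U \<in> {U. N \<subseteq> U \<and> open U}. emeasure M U) < ennreal e"
    using e by simp
  then obtain U where U: "N \<subseteq> U" "open U" "emeasure M U < ennreal e"
    by (auto simp: INF_less_iff)
  have "measure M U < e"
    using U(3) by (simp add: emeasure_eq_measure ennreal_less_iff)
  moreover have "space M = UNIV" using sets_eq_imp_space_eq[OF M] by simp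
  ultimately show ?thesis using that[of U] U N(1) by blast
qed

text \<open>
  A null set \<open>N\<close> of bad points is covered by an open \<open>U\<close> of measure less than \<open>e\<close>. Near a point of
  \<open>U\<close> the increments of \<open>H\<close> are charged to \<open>M\<close> restricted to \<open>U\<close>; near any other point they are
  at most \<open>e\<close> times the length. Both charges are additive over adjacent intervals, so a bisection
  argument spreads the estimate to the whole of \<open>[a, b]\<close>. The regularity of \<open>H\<close> enters
  only through a measure that dominates its increments from above; the local condition only concerns
  intervals inside \<open>[a, b]\<close>, so that it is one-sided at the end points.
\<close>

lemma AE_infinitesimally_nonincreasing_imp_le:
  fixes H :: "real \<Rightarrow> real" and M :: "real measure"
  assumes fin: "finite_measure M" and M: "sets M = sets borel"
    and ab: "a \<le> b"
    and ac: "\<And>s t. a \<le> s \<Longrightarrow> s \<le> t \<Longrightarrow> t \<le> b \<Longrightarrow> H t - H s \<le> measure M {s<..t}"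
    and local: "AE x in M. x \<in> {a..b} \<longrightarrow> (\<forall>e>0. \<exists>d>0. \<forall>s t.
      a \<le> s \<and> s \<le> x \<and> x \<le> t \<and> t \<le> b \<and> t - s < d \<longrightarrow> H t - H s \<le> e * (t - s))"
  shows "H b \<le> H a"
proof -
  interpret finite_measure M by fact
  have close: "H b - H a \<le> e + e * (b - a)" if e: "e > 0" for e
  proof -
    obtain U where U: "open U" "measure M U < e"
      and out: "\<And>x. x \<notin> U \<Longrightarrow> x \<in> {a..b} \<longrightarrow> (\<forall>e>0. \<exists>d>0. \<forall>s t.
          a \<le> s \<and> s \<le> x \<and> x \<le> t \<and> t \<le> b \<and> t - s < d \<longrightarrow> H t - H s \<le> e * (t - s))"
      using null_set_small_open_superset[OF fin M local e] by blast
    have sets[measurable]: "U \<in> sets M" "\<And>s t. {s<..t} \<in> sets M" using U M by auto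
    let ?P = "\<lambda>s t. a \<le> s \<and> t \<le> b \<longrightarrow> H t - H s \<le> measure M (U \<inter> {s<..t}) + e * (t - s)"
    from ab have "?P a b"
    proof (rule Bolzano[where P = ?P])
      fix s t r assume trans: "?P s t" "?P t r" "s \<le> t" "t \<le> r"
      have "U \<inter> {s<..r} = (U \<inter> {s<..t}) \<union> (U \<inter> {t<..r})" using trans by auto
      moreover have "measure M \<dots> = measure M (U \<inter> {s<..t}) + measure M (U \<inter> {t<..r})"
        by (intro finite_measure_Union) auto
      ultimately show "?P s r" using trans by (auto simp: algebra_simps)
    next
      fix x assume x: "a \<le> x" "x \<le> b"
      show "\<exists>d>0. \<forall>s t. s \<le> x \<and> x \<le> t \<and> t - s < d \<longrightarrow> ?P s t"
      proof (cases "x \<in> U")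
        case True
        then obtain d where d: "d > 0" "ball x d \<subseteq> U" using U(1) open_contains_ball by blast
        show ?thesis
        proof (intro exI[of _ d] conjI allI impI d(1))
          fix s t assume st: "s \<le> x \<and> x \<le> t \<and> t - s < d" "a \<le> s \<and> t \<le> b"
          have "{s<..t} \<subseteq> ball x d" using st by (auto simp: dist_real_def)
          then have "U \<inter> {s<..t} = {s<..t}" using d by auto
          then have "measure M (U \<inter> {s<..t}) = measure M {s<..t}" by (rule arg_cong)
          moreover have "H t - H s \<le> measure M {s<..t}" using st by (intro ac) auto
          moreover have "0 \<le> e * (t - s)" using st e by simp
          ultimately show "H t - H s \<le> measure M (U \<inter> {s<..t}) + e * (t - s)" by linarith
        qed
      next
        case False
        then have "\<exists>d>0. \<forall>s t. a \<le> s \<and> s \<le> x \<and> x \<le> t \<and> t \<le> b \<and> t - s < d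
            \<longrightarrow> H t - H s \<le> e * (t - s)"
        proof -
          have "x \<in> {a..b}" using x by simp
          from out[OF False, THEN mp, OF this] e show ?thesis by blast
        qed
        then obtain d where d: "d > 0" "\<forall>s t. a \<le> s \<and> s \<le> x \<and> x \<le> t \<and> t \<le> b \<and> t - s < d
            \<longrightarrow> H t - H s \<le> e * (t - s)"
          by blast
        show ?thesis
        proof (intro exI[of _ d] conjI allI impI d(1))
          fix s t assume "s \<le> x \<and> x \<le> t \<and> t - s < d" "a \<le> s \<and> t \<le> b"
          then have "H t - H s \<le> e * (t - s)" using d(2) by blast
          then show "H t - H s \<le> measure M (U \<inter> {s<..t}) + e * (t - s)"
            using measure_nonneg[of M "U \<inter> {s<..t}"] by linarith
        qed
      qed
    qed
    then have "H b - H a \<le> measure M (U \<inter> {a<..b}) + e * (b - a)" by simp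
    also have "measure M (U \<inter> {a<..b}) \<le> measure M U"
      by (intro finite_measure_mono) auto
    finally show ?thesis using U(2) by simp
  qed
  show ?thesis
  proof (rule field_le_epsilon)
    fix e' :: real assume "e' > 0"
    define k where "k = 1 + (b - a)"
    have k: "k > 0" using ab by (simp add: k_def)
    have "H b - H a \<le> e' / k + e' / k * (b - a)"
      using close[of "e' / k"] \<open>e' > 0\<close> k by simp
    also have "\<dots> = e' / k * k" by (simp only: k_def distrib_left mult_1_right)
    also have "\<dots> = e'" using k by simp
    finally show "H b \<le> H a + e'" by simp
  qed
qed

text \<open>
  Turns an integral bound on increments into the form with half-open intervals, which are
  disjoint when adjacent.
\<close>

lemma finite_measure_density_set_integrable:
  fixes g :: "real \<Rightarrow> real"
  assumes g: "set_integrable lborel {a..b} g" and nn: "\<And>u. 0 \<le> g u"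
  defines "M \<equiv> density lborel (\<lambda>u. ennreal (indicator {a..b} u * g u))"
  shows "finite_measure M" "sets M = sets borel"
    "\<And>s t. a \<le> s \<Longrightarrow> s \<le> t \<Longrightarrow> t \<le> b \<Longrightarrow> measure M {s<..t} = (LBINT u:{s..t}. g u)"
proof -
  have int: "integrable lborel (\<lambda>u. indicator {a..b} u * g u)"
    using g by (simp add: set_integrable_def)
  then have [measurable]: "(\<lambda>u. indicator {a..b} u * g u) \<in> borel_measurable lborel"
    by (rule borel_measurable_integrable)
  show "sets M = sets borel" by (simp add: M_def)
  have "emeasure M (space M) = (\<integral>\<^sup>+u. ennreal (indicator {a..b} u * g u) \<partial>lborel)"
    unfolding M_def by (subst emeasure_density) (auto intro!: nn_integral_cong)
  also have "\<dots> = ennreal (LBINT u. indicator {a..b} u * g u)"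
    using int nn by (intro nn_integral_eq_integral) auto
  finally show "finite_measure M" by (intro finite_measureI) simp
  fix s t assume st: "a \<le> s" "s \<le> t" "t \<le> b"
  have i: "integrable lborel (\<lambda>u. indicator {s..t} u * g u)"
    using set_integrable_subset[OF g, of "{s..t}"] st by (simp add: set_integrable_def)
  have "emeasure M {s<..t} = (\<integral>\<^sup>+u. ennreal (indicator {a..b} u * g u) * indicator {s<..t} u \<partial>lborel)"
    unfolding M_def by (subst emeasure_density) auto
  also have "\<dots> = (\<integral>\<^sup>+u. ennreal (indicator {s..t} u * g u) \<partial>lborel)"
    using AE_lborel_singleton[of s] st
    by (intro nn_integral_cong_AE) (auto split: split_indicator)
  also have "\<dots> = ennreal (LBINT u. indicator {s..t} u * g u)"
    using i nn by (intro nn_integral_eq_integral) auto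
  finally show "measure M {s<..t} = (LBINT u:{s..t}. g u)"
    using nn by (simp add: measure_def set_lebesgue_integral_def integral_nonneg_AE)
qed

section \<open>Quadratic estimates along couplings\<close>

lemma integral_Cauchy_Schwarz:
  fixes f g :: "'a \<Rightarrow> real"
  assumes [measurable]: "f \<in> borel_measurable M" "g \<in> borel_measurable M"
    and f: "integrable M (\<lambda>x. (f x)\<^sup>2)" and g: "integrable M (\<lambda>x. (g x)\<^sup>2)"
  shows "integrable M (\<lambda>x. f x * g x)"
    and "(\<integral>x. \<bar>f x * g x\<bar> \<partial>M) \<le> sqrt (\<integral>x. (f x)\<^sup>2 \<partial>M) * sqrt (\<integral>x. (g x)\<^sup>2 \<partial>M)"
proof -
  have "\<bar>a * b\<bar> \<le> a\<^sup>2 + b\<^sup>2" for a b :: real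
  proof -
    have "2 * (\<bar>a\<bar> * \<bar>b\<bar>) \<le> a\<^sup>2 + b\<^sup>2"
      using zero_le_power2[of "\<bar>a\<bar> - \<bar>b\<bar>"] by (simp add: power2_diff)
    moreover have "0 \<le> \<bar>a\<bar> * \<bar>b\<bar>" by simp
    ultimately show ?thesis unfolding abs_mult by linarith
  qed
  then show fg: "integrable M (\<lambda>x. f x * g x)"
    by (intro Bochner_Integration.integrable_bound[OF Bochner_Integration.integrable_add[OF f g]]) auto
  have "ennreal ((\<integral>x. \<bar>f x * g x\<bar> \<partial>M)\<^sup>2) = (\<integral>\<^sup>+x. ennreal \<bar>f x\<bar> * ennreal \<bar>g x\<bar> \<partial>M)\<^sup>2"
    using fg by (simp add: nn_integral_eq_integral ennreal_mult[symmetric] abs_mult[symmetric]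
        ennreal_power)
  also have "\<dots> \<le> (\<integral>\<^sup>+x. (ennreal \<bar>f x\<bar>)\<^sup>2 \<partial>M) * (\<integral>\<^sup>+x. (ennreal \<bar>g x\<bar>)\<^sup>2 \<partial>M)"
    by (rule Cauchy_Schwarz_nn_integral) auto
  also have "\<dots> = ennreal ((\<integral>x. (f x)\<^sup>2 \<partial>M) * (\<integral>x. (g x)\<^sup>2 \<partial>M))"
    using f g by (simp add: nn_integral_eq_integral ennreal_power ennreal_mult)
  finally have "(\<integral>x. \<bar>f x * g x\<bar> \<partial>M)\<^sup>2 \<le> (\<integral>x. (f x)\<^sup>2 \<partial>M) * (\<integral>x. (g x)\<^sup>2 \<partial>M)"
    by (subst (asm) ennreal_le_iff) auto
  then show "(\<integral>x. \<bar>f x * g x\<bar> \<partial>M) \<le> sqrt (\<integral>x. (f x)\<^sup>2 \<partial>M) * sqrt (\<integral>x. (g x)\<^sup>2 \<partial>M)"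
    by (simp add: real_le_rsqrt real_sqrt_mult[symmetric])
qed

lemma integral_coupling:
  fixes f :: "'a::euclidean_space \<Rightarrow> real"
  assumes \<gamma>: "\<gamma> \<in> couplings \<mu> \<nu>" and f: "f \<in> borel_measurable borel"
  shows "(\<integral>z. f (fst z) \<partial>\<gamma>) = (\<integral>x. f x \<partial>\<mu>)" "(\<integral>z. f (snd z) \<partial>\<gamma>) = (\<integral>x. f x \<partial>\<nu>)"
    and "integrable \<gamma> (\<lambda>z. f (fst z)) \<longleftrightarrow> integrable \<mu> f"
    "integrable \<gamma> (\<lambda>z. f (snd z)) \<longleftrightarrow> integrable \<nu> f"
  using integral_distr[OF coupling_measurable(1)[OF \<gamma>] f] integral_distr[OF coupling_measurable(2)[OF \<gamma>] f]
    integrable_distr_eq[OF coupling_measurable(1)[OF \<gamma>] f] integrable_distr_eq[OF coupling_measurable(2)[OF \<gamma>] f]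
  unfolding couplingsD(2,3)[OF \<gamma>] by simp_all

text \<open>
  The estimates on a displacement \<open>\<delta>\<close> of mean square at most \<open>A\<^sup>2\<close>, collected once for all
  couplings.
\<close>

lemma coupling_L2:
  fixes \<mu> \<nu> :: "'a::euclidean_space measure"
  assumes \<gamma>: "\<gamma> \<in> couplings \<mu> \<nu>" and \<mu>: "\<mu> \<in> P2"
    and A: "transport_cost \<gamma> \<le> ennreal (A\<^sup>2)" "0 \<le> A"
  defines "\<delta> \<equiv> \<lambda>z. dist (fst z) (snd z)"
  shows "\<delta> \<in> borel_measurable \<gamma>" "(\<lambda>z. norm (fst z)) \<in> borel_measurable \<gamma>"
    and "integrable \<gamma> (\<lambda>z. (\<delta> z)\<^sup>2)" "(\<integral>z. (\<delta> z)\<^sup>2 \<partial>\<gamma>) \<le> A\<^sup>2"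
    and "integrable \<gamma> \<delta>" "(\<integral>z. \<delta> z \<partial>\<gamma>) \<le> A"
    and "integrable \<gamma> (\<lambda>z. norm (fst z) * \<delta> z)" "(\<integral>z. norm (fst z) * \<delta> z \<partial>\<gamma>) \<le> sqrt (m2 \<mu>) * A"
    and "integrable \<gamma> (\<lambda>z. (norm (fst z))\<^sup>2)" "(\<integral>z. (norm (fst z))\<^sup>2 \<partial>\<gamma>) = m2 \<mu>"
proof -
  interpret prob_space \<gamma> by (rule coupling_prob_space[OF \<gamma> \<mu>])
  note [measurable] = coupling_measurable[OF \<gamma>]
  show d[measurable]: "\<delta> \<in> borel_measurable \<gamma>" and n[measurable]: "(\<lambda>z. norm (fst z)) \<in> borel_measurable \<gamma>"
    unfolding \<delta>_def by measurable
  have nn: "(\<integral>\<^sup>+z. ennreal ((\<delta> z)\<^sup>2) \<partial>\<gamma>) \<le> ennreal (A\<^sup>2)"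
    using A(1) by (simp add: transport_cost_def \<delta>_def)
  then have "(\<integral>\<^sup>+z. ennreal ((\<delta> z)\<^sup>2) \<partial>\<gamma>) < \<infinity>"
    by (rule le_less_trans) simp
  then show d2: "integrable \<gamma> (\<lambda>z. (\<delta> z)\<^sup>2)"
    by (intro integrableI_nonneg) auto
  show d2_le: "(\<integral>z. (\<delta> z)\<^sup>2 \<partial>\<gamma>) \<le> A\<^sup>2"
    using nn nn_integral_eq_integral[OF d2] by simp
  then have d2_sqrt: "sqrt (\<integral>z. (\<delta> z)\<^sup>2 \<partial>\<gamma>) \<le> A"
    using A(2) real_le_lsqrt by blast
  show d1: "integrable \<gamma> \<delta>"
    using square_integrable_imp_integrable[OF d d2] .
  show "(\<integral>z. \<delta> z \<partial>\<gamma>) \<le> A"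
    using integral_Cauchy_Schwarz(2)[OF d borel_measurable_const d2, of 1] d2_sqrt
    by (simp add: prob_space \<delta>_def)
  show n2: "integrable \<gamma> (\<lambda>z. (norm (fst z))\<^sup>2)" and n2_eq: "(\<integral>z. (norm (fst z))\<^sup>2 \<partial>\<gamma>) = m2 \<mu>"
    using integral_coupling(1,3)[OF \<gamma>, of "\<lambda>x. (norm x)\<^sup>2"] P2D(3)[OF \<mu>] by (auto simp: m2_def)
  show "integrable \<gamma> (\<lambda>z. norm (fst z) * \<delta> z)"
    by (rule integral_Cauchy_Schwarz(1)[OF n d n2 d2])
  have "(\<integral>z. norm (fst z) * \<delta> z \<partial>\<gamma>) \<le> sqrt (m2 \<mu>) * sqrt (\<integral>z. (\<delta> z)\<^sup>2 \<partial>\<gamma>)"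
    using integral_Cauchy_Schwarz(2)[OF n d n2 d2] by (simp add: n2_eq \<delta>_def)
  also have "\<dots> \<le> sqrt (m2 \<mu>) * A"
    using d2_sqrt by (intro mult_left_mono) (auto simp: m2_def)
  finally show "(\<integral>z. norm (fst z) * \<delta> z \<partial>\<gamma>) \<le> sqrt (m2 \<mu>) * A" .
qed

text \<open>
  Passes from near-optimal couplings to the distance itself.
\<close>

lemma le_mult_W2I:
  assumes K: "0 \<le> K" and le: "\<And>A. W2 \<mu> \<nu> < A \<Longrightarrow> a \<le> c + K * A"
  shows "a \<le> c + K * W2 \<mu> \<nu>"
proof (rule field_le_epsilon)
  fix e :: real assume e: "e > 0"
  have "a \<le> c + K * (W2 \<mu> \<nu> + e / (K + 1))"
    using e K by (intro le) simp
  also have "\<dots> = c + K * W2 \<mu> \<nu> + e * (K / (K + 1))"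
    by (simp add: algebra_simps)
  also have "\<dots> \<le> c + K * W2 \<mu> \<nu> + e * 1"
    using e K by (intro add_left_mono mult_left_mono) auto
  finally show "a \<le> c + K * W2 \<mu> \<nu> + e" by simp
qed

text \<open>
  The square root of the second moment is the distance to the Dirac measure at the origin, so this
  is a triangle inequality; along a single coupling it is Minkowski's inequality in \<open>L\<^sup>2\<close>.
\<close>

lemma sqrt_m2_le_W2:
  fixes \<mu> \<nu> :: "'a::euclidean_space measure"
  assumes \<mu>: "\<mu> \<in> P2" and \<nu>: "\<nu> \<in> P2"
  shows "sqrt (m2 \<nu>) \<le> sqrt (m2 \<mu>) + W2 \<mu> \<nu>"
proof -
  have "sqrt (m2 \<nu>) \<le> sqrt (m2 \<mu>) + 1 * W2 \<mu> \<nu>"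
  proof (rule le_mult_W2I)
    fix A assume "W2 \<mu> \<nu> < A"
    then have A0: "0 \<le> A" using W2_nonneg[of \<mu> \<nu>] by linarith
    obtain \<gamma> where \<gamma>: "\<gamma> \<in> couplings \<mu> \<nu>" and A: "transport_cost \<gamma> \<le> ennreal (A\<^sup>2)"
      using near_optimal_coupling[OF \<mu> \<nu> \<open>W2 \<mu> \<nu> < A\<close>] by blast
    note L2 = coupling_L2[OF \<gamma> \<mu> A A0]
    have m0: "0 \<le> m2 \<mu>" by (simp add: m2_def)
    have pt: "(norm (snd z))\<^sup>2 \<le> (norm (fst z))\<^sup>2 + 2 * (norm (fst z) * dist (fst z) (snd z)) + (dist (fst z) (snd z))\<^sup>2"
      for z :: "'a \<times> 'a"
    proof -
      have "norm (snd z) \<le> norm (fst z) + dist (fst z) (snd z)"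
        unfolding dist_norm by norm
      then have "(norm (snd z))\<^sup>2 \<le> (norm (fst z) + dist (fst z) (snd z))\<^sup>2"
        by (simp add: power_mono)
      then show ?thesis by (simp add: power2_sum)
    qed
    have "m2 \<nu> = (\<integral>z. (norm (snd z))\<^sup>2 \<partial>\<gamma>)"
      using integral_coupling(2)[OF \<gamma>, of "\<lambda>x. (norm x)\<^sup>2"] by (simp add: m2_def)
    also have "\<dots> \<le> (\<integral>z. (norm (fst z))\<^sup>2 + 2 * (norm (fst z) * dist (fst z) (snd z)) + (dist (fst z) (snd z))\<^sup>2 \<partial>\<gamma>)"
    proof (rule integral_mono[OF _ _ pt])
      show "integrable \<gamma> (\<lambda>z. (norm (snd z))\<^sup>2)"
        using integral_coupling(4)[OF \<gamma>, of "\<lambda>x. (norm x)\<^sup>2"] P2D(3)[OF \<nu>] by simp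
    qed (use L2 in auto)
    also have "\<dots> = m2 \<mu> + 2 * (\<integral>z. norm (fst z) * dist (fst z) (snd z) \<partial>\<gamma>)
        + (\<integral>z. (dist (fst z) (snd z))\<^sup>2 \<partial>\<gamma>)"
      using L2 by simp
    also have "\<dots> \<le> m2 \<mu> + 2 * (sqrt (m2 \<mu>) * A) + A\<^sup>2"
      using L2(4,8) by (intro add_mono) auto
    also have "\<dots> = (sqrt (m2 \<mu>) + A)\<^sup>2"
      using m0 by (simp add: power2_sum)
    finally show "sqrt (m2 \<nu>) \<le> sqrt (m2 \<mu>) + 1 * A"
      using A0 m0 by (simp add: real_le_lsqrt)
  qed simp
  then show ?thesis by simp
qed

section \<open>Energy dissipation along curves of maximal slope\<close>

text \<open>
  The monotonicity principle is applied to \<open>H(t) = F(\<mu>\<^sub>t) + c D(t) - c\<^sup>2 t / 4\<close>, where \<open>D\<close> is the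
  distance from the starting point. The bound on \<open>F\<close> has the second moment in its constant; on
  \<open>[0, T]\<close> this moment is bounded, so the increments of \<open>F\<close> along the curve are at most a constant
  times the distance, hence dominated by the integral of a multiple of \<open>|m|\<close>, where \<open>m\<close> is a
  speed bound from the absolute continuity of the curve.
\<close>

lemma maximal_slope_dissipation:
  fixes \<mu>t :: "real \<Rightarrow> 'a::euclidean_space measure" and F :: "'a measure \<Rightarrow> real"
  assumes AC: "AC2_loc \<mu>t"
    and F: "\<And>\<mu> \<nu>. \<mu> \<in> P2 \<Longrightarrow> \<nu> \<in> P2 \<Longrightarrow> F \<mu> - F \<nu> \<le> B * (1 + sqrt (m2 \<mu>))\<^sup>2 * W2 \<mu> \<nu>"
    and B: "0 \<le> B"
    and slope: "AE t in lborel. t > 0 \<longrightarrow> (\<exists>v. has_metric_derivative \<mu>t v t \<and>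
      ((\<lambda>s. F (\<mu>t s)) has_real_derivative - (v\<^sup>2)) (at t))"
    and T: "T > 0"
  shows "F (\<mu>t T) + (W2 (\<mu>t 0) (\<mu>t T))\<^sup>2 / T \<le> F (\<mu>t 0)"
proof -
  have P2: "\<mu>t t \<in> P2" if "0 \<le> t" for t using AC that by (simp add: AC2_loc_def)
  obtain m where m: "set_borel_measurable lborel {0..T} m"
      "set_integrable lborel {0..T} (\<lambda>u. (m u)\<^sup>2)"
    and W2_m: "\<And>s t. 0 \<le> s \<Longrightarrow> s \<le> t \<Longrightarrow> t \<le> T \<Longrightarrow> W2 (\<mu>t s) (\<mu>t t) \<le> (LBINT u:{s..t}. m u)"
    using AC T unfolding AC2_loc_def by (meson less_imp_le order_refl)
  have abs_m: "set_integrable lborel {0..T} (\<lambda>u. \<bar>m u\<bar>)"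
  proof -
    have one: "set_integrable lborel {0..T} (\<lambda>u. 1 + (m u)\<^sup>2)"
      by (rule set_integral_add(1)[OF _ m(2)]) (simp add: set_integrable_def integrable_indicator_iff emeasure_lborel_Icc_eq)
    have "\<bar>r\<bar> \<le> 1 + r\<^sup>2" for r :: real
    proof -
      have "2 * \<bar>r\<bar> \<le> 1 + r\<^sup>2"
        using zero_le_power2[of "\<bar>r\<bar> - 1"] by (simp add: power2_diff)
      then show ?thesis using abs_ge_zero[of r] by linarith
    qed
    moreover have "(\<lambda>u. indicator {0..T} u *\<^sub>R \<bar>m u\<bar>) = (\<lambda>u. \<bar>indicator {0..T} u *\<^sub>R m u\<bar>)"
      by (auto split: split_indicator)
    ultimately show ?thesis
      using m(1) unfolding set_integrable_def set_borel_measurable_def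
      by (intro Bochner_Integration.integrable_bound[OF one[unfolded set_integrable_def]])
        (auto split: split_indicator)
  qed
  define q where "q = sqrt (m2 (\<mu>t 0)) + (LBINT u:{0..T}. \<bar>m u\<bar>)"
  define D where "D t = W2 (\<mu>t 0) (\<mu>t t)" for t
  \<comment> \<open>the value of \<open>c\<close> that maximises \<open>c D(T) - c\<^sup>2 T / 4\<close>\<close>
  define c where "c = 2 * D T / T"
  \<comment> \<open>the final \<open>1\<close> keeps \<open>K\<close> positive, so that bounds on \<open>K\<close> times a distance can be divided by \<open>K\<close>\<close>
  define K where "K = B * (1 + q)\<^sup>2 + c + 1"
  define g where "g u = K * \<bar>m u\<bar>" for u
  have sub: "set_integrable lborel {s..t} (\<lambda>u. \<bar>m u\<bar>)" if "0 \<le> s" "t \<le> T" for s t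
    using that by (intro set_integrable_subset[OF abs_m]) auto
  have W2_abs: "W2 (\<mu>t s) (\<mu>t t) \<le> (LBINT u:{s..t}. \<bar>m u\<bar>)" if "0 \<le> s" "s \<le> t" "t \<le> T" for s t
  proof -
    have "set_borel_measurable lborel {s..t} m"
      using set_borel_measurable_subset[OF m(1), of "{s..t}"] that by auto
    then have "set_integrable lborel {s..t} m"
      using sub[of s t] that by (subst set_integrable_abs_iff[symmetric]) auto
    then have "(LBINT u:{s..t}. m u) \<le> (LBINT u:{s..t}. \<bar>m u\<bar>)"
      using sub[of s t] that by (intro set_integral_mono) auto
    then show ?thesis using W2_m[OF that] by linarith
  qed
  have m2_q: "sqrt (m2 (\<mu>t t)) \<le> q" if t: "0 \<le> t" "t \<le> T" for t
  proof -
    have "(LBINT u:{0..t}. \<bar>m u\<bar>) \<le> (LBINT u:{0..T}. \<bar>m u\<bar>)"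
      using t abs_m sub[of 0 t] unfolding set_lebesgue_integral_def set_integrable_def
      by (intro integral_mono) (auto split: split_indicator)
    then show ?thesis
      using sqrt_m2_le_W2[OF P2[of 0] P2[of t]] W2_abs[of 0 t] t by (simp add: q_def)
  qed
  have c: "0 \<le> c" using T by (simp add: c_def D_def W2_nonneg)
  have q: "0 \<le> B * (1 + q)\<^sup>2" using B by simp
  have K: "1 \<le> K" using c q by (simp add: K_def)
  have g_int: "set_integrable lborel {0..T} g"
    unfolding g_def using abs_m by simp
  have g_nn: "0 \<le> g u" for u using K by (simp add: g_def)
  define M where "M = density lborel (\<lambda>u. ennreal (indicator {0..T} u * g u))"
  note M = finite_measure_density_set_integrable[OF g_int g_nn, folded M_def]
  have KW2: "K * W2 (\<mu>t s) (\<mu>t t) \<le> measure M {s<..t}" if "0 \<le> s" "s \<le> t" "t \<le> T" for s t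
  proof -
    have "K * W2 (\<mu>t s) (\<mu>t t) \<le> K * (LBINT u:{s..t}. \<bar>m u\<bar>)"
      using W2_abs[OF that] K by (intro mult_left_mono) auto
    also have "\<dots> = measure M {s<..t}"
      unfolding M(3)[OF that] g_def by simp
    finally show ?thesis .
  qed
  \<comment> \<open>the interval \<open>{x<..x}\<close> is empty\<close>
  have W2_self: "W2 (\<mu>t x) (\<mu>t x) = 0" if "0 \<le> x" "x \<le> T" for x
    using KW2[of x x] that K W2_nonneg[of "\<mu>t x" "\<mu>t x"] by (simp add: mult_le_0_iff)
  have D_diff: "D t - D s \<le> W2 (\<mu>t s) (\<mu>t t)" if "0 \<le> s" "0 \<le> t" for s t
    using W2_triangle[OF P2[of 0] P2[OF that(1)] P2[OF that(2)]] by (simp add: D_def)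
  define H where "H t = F (\<mu>t t) + c * D t - c\<^sup>2 / 4 * t" for t
  have "H T \<le> H 0"
  proof (rule AE_infinitesimally_nonincreasing_imp_le[where H = H, OF M(1,2)])
    show "0 \<le> T" using T by simp
    show "H t - H s \<le> measure M {s<..t}" if st: "0 \<le> s" "s \<le> t" "t \<le> T" for s t
    proof -
      let ?W = "W2 (\<mu>t s) (\<mu>t t)"
      have "F (\<mu>t t) - F (\<mu>t s) \<le> B * (1 + sqrt (m2 (\<mu>t t)))\<^sup>2 * ?W"
        using F[OF P2[of t] P2[of s]] st W2_commute[of "\<mu>t t" "\<mu>t s"] by simp
      also have "\<dots> \<le> B * (1 + q)\<^sup>2 * ?W"
        using m2_q[of t] st B W2_nonneg
        by (intro mult_right_mono mult_left_mono power_mono) (auto simp: m2_def)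
      finally have "F (\<mu>t t) - F (\<mu>t s) \<le> B * (1 + q)\<^sup>2 * ?W" .
      moreover have "c * D t - c * D s \<le> c * ?W"
        using D_diff[of s t] st c by (simp add: right_diff_distrib[symmetric] mult_left_mono)
      moreover have "c\<^sup>2 / 4 * s \<le> c\<^sup>2 / 4 * t"
        using st by (intro mult_left_mono) auto
      moreover have "K * ?W = B * (1 + q)\<^sup>2 * ?W + c * ?W + ?W"
        by (simp add: K_def algebra_simps)
      ultimately show ?thesis
        using KW2[OF st] W2_nonneg[of "\<mu>t s" "\<mu>t t"] unfolding H_def by linarith
    qed
    show "AE x in M. x \<in> {0..T} \<longrightarrow> (\<forall>e>0. \<exists>d>0. \<forall>s t.
      0 \<le> s \<and> s \<le> x \<and> x \<le> t \<and> t \<le> T \<and> t - s < d \<longrightarrow> H t - H s \<le> e * (t - s))"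
    proof -
      have pt: "\<exists>d>0. \<forall>s t. 0 \<le> s \<and> s \<le> x \<and> x \<le> t \<and> t \<le> T \<and> t - s < d \<longrightarrow> H t - H s \<le> e * (t - s)"
        if x: "x \<in> {0..T}" and v: "has_metric_derivative \<mu>t v x"
          and dF: "((\<lambda>s. F (\<mu>t s)) has_real_derivative - (v\<^sup>2)) (at x)" and e: "e > 0" for x v e
      proof -
        \<comment> \<open>both difference quotients are off by less than \<open>e'\<close>, which enters \<open>H\<close> with total weight \<open>1 + c\<close>\<close>
        define e' where "e' = e / (1 + c)"
        have e': "e' > 0" using e c by (simp add: e'_def)
        obtain d1 where d1: "d1 > 0" and F_near: "\<And>s. s \<noteq> x \<Longrightarrow> \<bar>s - x\<bar> < d1 \<Longrightarrow>
            \<bar>(F (\<mu>t s) - F (\<mu>t x)) / (s - x) - - (v\<^sup>2)\<bar> < e'"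
          using LIM_D[OF dF[unfolded has_field_derivative_iff] e'] by (auto simp: real_norm_def)
        obtain d2 where d2: "d2 > 0" and W_near: "\<And>s. s \<noteq> x \<Longrightarrow> \<bar>s - x\<bar> < d2 \<Longrightarrow>
            \<bar>W2 (\<mu>t s) (\<mu>t x) / \<bar>s - x\<bar> - v\<bar> < e'"
          using LIM_D[OF v[unfolded has_metric_derivative_def] e'] by (auto simp: real_norm_def)
        have W_le: "W2 (\<mu>t s) (\<mu>t x) \<le> (v + e') * \<bar>s - x\<bar>" if "\<bar>s - x\<bar> < d2" for s
        proof (cases "s = x")
          case True
          then show ?thesis using W2_self x by simp
        next
          case False
          then have "W2 (\<mu>t s) (\<mu>t x) / \<bar>s - x\<bar> \<le> v + e'" using W_near[OF False that] by linarith
          then show ?thesis using False by (simp add: pos_divide_le_eq)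
        qed
        have F_right: "F (\<mu>t t) - F (\<mu>t x) \<le> (e' - v\<^sup>2) * (t - x)" if "x \<le> t" "t - x < d1" for t
        proof (cases "t = x")
          case False
          then have "(F (\<mu>t t) - F (\<mu>t x)) / (t - x) \<le> e' - v\<^sup>2" using F_near[of t] that by simp
          then show ?thesis using False that by (simp add: pos_divide_le_eq)
        qed simp
        have F_left: "F (\<mu>t x) - F (\<mu>t s) \<le> (e' - v\<^sup>2) * (x - s)" if "s \<le> x" "x - s < d1" for s
        proof (cases "s = x")
          case False
          then have "(F (\<mu>t x) - F (\<mu>t s)) / (x - s) \<le> e' - v\<^sup>2"
            using F_near[of s] that minus_divide_divide[of "F (\<mu>t x) - F (\<mu>t s)" "x - s"] by simp
          then show ?thesis using False that by (simp add: pos_divide_le_eq)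
        qed simp
        have "H t - H s \<le> e * (t - s)"
          if st: "0 \<le> s" "s \<le> x" "x \<le> t" "t \<le> T" "t - s < min d1 d2" for s t
        proof -
          have "F (\<mu>t t) - F (\<mu>t s) \<le> (e' - v\<^sup>2) * (t - x) + (e' - v\<^sup>2) * (x - s)"
            using F_right[of t] F_left[of s] st by simp
          also have "\<dots> = (e' - v\<^sup>2) * (t - s)" by (simp add: algebra_simps)
          finally have dF_st: "F (\<mu>t t) - F (\<mu>t s) \<le> (e' - v\<^sup>2) * (t - s)" .
          have "D t - D s \<le> W2 (\<mu>t s) (\<mu>t t)" using D_diff st by simp
          also have "\<dots> \<le> W2 (\<mu>t s) (\<mu>t x) + W2 (\<mu>t x) (\<mu>t t)"
            using st by (intro W2_triangle P2) auto
          also have "\<dots> \<le> (v + e') * (x - s) + (v + e') * (t - x)"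
            using W_le[of s] W_le[of t] st W2_commute[of "\<mu>t x" "\<mu>t t"] by simp
          also have "\<dots> = (v + e') * (t - s)" by (simp add: algebra_simps)
          finally have "c * (D t - D s) \<le> c * ((v + e') * (t - s))"
            using c by (rule mult_left_mono)
          moreover have "H t - H s = (F (\<mu>t t) - F (\<mu>t s)) + c * (D t - D s) - c\<^sup>2 / 4 * (t - s)"
            by (simp add: H_def right_diff_distrib)
          ultimately have "H t - H s \<le> (e' - v\<^sup>2) * (t - s) + c * ((v + e') * (t - s)) - c\<^sup>2 / 4 * (t - s)"
            using dF_st by linarith
          also have "\<dots> = e' * (1 + c) * (t - s) - (v - c / 2)\<^sup>2 * (t - s)"
            by (simp add: power2_eq_square algebra_simps)
          also have "\<dots> \<le> e' * (1 + c) * (t - s)"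
            using st by simp
          also have "\<dots> = e * (t - s)" using c by (simp add: e'_def)
          finally show ?thesis .
        qed
        then show ?thesis using d1 d2 by (intro exI[of _ "min d1 d2"]) auto
      qed
      have "AE x in lborel. x \<in> {0..T} \<longrightarrow> (\<forall>e>0. \<exists>d>0. \<forall>s t.
        0 \<le> s \<and> s \<le> x \<and> x \<le> t \<and> t \<le> T \<and> t - s < d \<longrightarrow> H t - H s \<le> e * (t - s))"
        using slope AE_lborel_singleton[of 0]
      proof eventually_elim
        case (elim x)
        show ?case
        proof (intro impI allI)
          fix e :: real assume x: "x \<in> {0..T}" and e: "e > 0"
          then have "x > 0" using elim(2) by simp
          then obtain v where "has_metric_derivative \<mu>t v x"
            "((\<lambda>s. F (\<mu>t s)) has_real_derivative - (v\<^sup>2)) (at x)"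
            using elim(1) by blast
          then show "\<exists>d>0. \<forall>s t. 0 \<le> s \<and> s \<le> x \<and> x \<le> t \<and> t \<le> T \<and> t - s < d \<longrightarrow> H t - H s \<le> e * (t - s)"
            using pt[OF x _ _ e] by blast
        qed
      qed
      moreover have "(\<lambda>u. ennreal (indicator {0..T} u * g u)) \<in> borel_measurable lborel"
        using g_int by (auto simp: set_integrable_def dest: borel_measurable_integrable)
      ultimately show ?thesis
        unfolding M_def by (subst AE_density) auto
    qed
  qed
  moreover have "D 0 = 0" using W2_self[of 0] T by (simp add: D_def)
  moreover have "c * D T - c\<^sup>2 / 4 * T = (D T)\<^sup>2 / T"
    using T by (simp add: c_def field_simps power2_eq_square)
  ultimately show ?thesis by (simp add: H_def D_def)
qed

section \<open>Regularity of the network and of the loss\<close>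

lemma neuron_bound:
  fixes \<sigma> :: "real \<Rightarrow> real" and x :: "real ^ 'd::finite"
  assumes bdd: "\<And>z. \<bar>\<sigma> z\<bar> \<le> S"
  shows "\<bar>case p of (w, a, b) \<Rightarrow> w * \<sigma> (a \<bullet> x + b)\<bar> \<le> S * norm (p :: 'd param)"
proof -
  obtain w a b where p: "p = (w, a, b)" by (cases p) auto
  have "\<bar>w\<bar> \<le> norm p" using norm_fst_le[of w "(a, b)"] by (simp add: p)
  then have "\<bar>w\<bar> * \<bar>\<sigma> (a \<bullet> x + b)\<bar> \<le> norm p * S"
    by (intro mult_mono bdd) auto
  then show ?thesis by (simp add: p abs_mult mult.commute)
qed

text \<open>
  A bounded Lipschitz \<open>\<sigma>\<close> makes \<open>w \<sigma>(a \<bullet> x + b)\<close> Lipschitz only on sets where \<open>w\<close> is bounded; the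
  factor \<open>norm p\<close> compensates for it.
\<close>

lemma neuron_diff_bound:
  fixes \<sigma> :: "real \<Rightarrow> real" and x :: "real ^ 'd::finite"
  assumes S: "0 \<le> S" and lip: "\<And>z z'. \<bar>\<sigma> z - \<sigma> z'\<bar> \<le> S * \<bar>z - z'\<bar>" and bdd: "\<And>z. \<bar>\<sigma> z\<bar> \<le> S"
  shows "\<bar>(case q of (w, a, b) \<Rightarrow> w * \<sigma> (a \<bullet> x + b)) - (case p of (w, a, b) \<Rightarrow> w * \<sigma> (a \<bullet> x + b))\<bar>
    \<le> S * dist p q + S * (norm x + 1) * (norm p * dist p (q :: 'd param))"
proof -
  obtain w a b where p: "p = (w, a, b)" by (cases p) auto
  obtain w' a' b' where q: "q = (w', a', b')" by (cases q) auto
  have n: "norm (q - p) = dist p q" by (simp add: dist_norm norm_minus_commute)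
  have w: "\<bar>w' - w\<bar> \<le> dist p q"
    using norm_fst_le[of "w' - w" "(a' - a, b' - b)"] unfolding n[symmetric] by (simp add: p q)
  have ab: "norm (a' - a, b' - b) \<le> dist p q"
    using norm_snd_le[of "(a' - a, b' - b)" "w' - w"] unfolding n[symmetric] by (simp add: p q)
  have a: "norm (a' - a) \<le> dist p q" and b: "\<bar>b' - b\<bar> \<le> dist p q"
    using norm_fst_le[of "a' - a" "b' - b"] norm_snd_le[of "b' - b" "a' - a"] ab by simp_all
  have wp: "\<bar>w\<bar> \<le> norm p" using norm_fst_le[of w "(a, b)"] by (simp add: p)
  have "(a' \<bullet> x + b') - (a \<bullet> x + b) = (a' - a) \<bullet> x + (b' - b)"
    by (simp add: inner_diff_left)
  then have "\<bar>(a' \<bullet> x + b') - (a \<bullet> x + b)\<bar> \<le> \<bar>(a' - a) \<bullet> x\<bar> + \<bar>b' - b\<bar>"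
    by linarith
  also have "\<dots> \<le> dist p q * norm x + dist p q"
    using Cauchy_Schwarz_ineq2[of "a' - a" x] mult_right_mono[OF a norm_ge_zero[of x]] b by linarith
  finally have "\<bar>(a' \<bullet> x + b') - (a \<bullet> x + b)\<bar> \<le> (norm x + 1) * dist p q"
    by (simp add: algebra_simps)
  then have s: "\<bar>\<sigma> (a' \<bullet> x + b') - \<sigma> (a \<bullet> x + b)\<bar> \<le> S * ((norm x + 1) * dist p q)"
    using lip[of "a' \<bullet> x + b'" "a \<bullet> x + b"] S by (meson mult_left_mono order_trans)
  have "w' * \<sigma> (a' \<bullet> x + b') - w * \<sigma> (a \<bullet> x + b)
    = (w' - w) * \<sigma> (a' \<bullet> x + b') + w * (\<sigma> (a' \<bullet> x + b') - \<sigma> (a \<bullet> x + b))"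
    by (simp add: algebra_simps)
  also have "\<bar>\<dots>\<bar> \<le> \<bar>w' - w\<bar> * \<bar>\<sigma> (a' \<bullet> x + b')\<bar> + \<bar>w\<bar> * \<bar>\<sigma> (a' \<bullet> x + b') - \<sigma> (a \<bullet> x + b)\<bar>"
    using abs_triangle_ineq by (simp add: abs_mult[symmetric])
  also have "\<dots> \<le> dist p q * S + norm p * (S * ((norm x + 1) * dist p q))"
    using w wp bdd s by (intro add_mono mult_mono) auto
  finally show ?thesis by (simp add: p q algebra_simps)
qed

lemma integrable_norm_P2:
  assumes "\<mu> \<in> P2"
  shows "integrable \<mu> norm" and "(\<integral>\<theta>. norm \<theta> \<partial>\<mu>) \<le> sqrt (m2 \<mu>)"
proof -
  interpret prob_space \<mu> by (rule P2D(1)[OF assms])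
  note [measurable_cong] = P2D(2)[OF assms]
  have n: "norm \<in> borel_measurable \<mu>" by measurable
  show "integrable \<mu> norm"
    by (rule square_integrable_imp_integrable[OF n P2D(3)[OF assms]])
  show "(\<integral>\<theta>. norm \<theta> \<partial>\<mu>) \<le> sqrt (m2 \<mu>)"
    using integral_Cauchy_Schwarz(2)[OF n borel_measurable_const P2D(3)[OF assms], of 1]
    by (simp add: m2_def prob_space)
qed

context
  fixes \<sigma> :: "real \<Rightarrow> real" and S :: real
  assumes S: "0 \<le> S"
    and lip: "\<And>z z'. \<bar>\<sigma> z - \<sigma> z'\<bar> \<le> S * \<bar>z - z'\<bar>"
    and bdd: "\<And>z. \<bar>\<sigma> z\<bar> \<le> S"
begin

lemma neuron_measurable:
  fixes x :: "real ^ 'd::finite"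
  shows "(\<lambda>(w, a, b). w * \<sigma> (a \<bullet> x + b)) \<in> borel_measurable (borel :: 'd param measure)"
proof -
  have "continuous_on UNIV \<sigma>"
  proof (rule lipschitz_on_continuous_on)
    show "S-lipschitz_on UNIV \<sigma>"
      using S lip by (intro lipschitz_onI) (auto simp: dist_real_def)
  qed
  then have \<sigma>: "\<sigma> \<in> borel_measurable borel" by (rule borel_measurable_continuous_onI)
  have "(\<lambda>p :: 'd param. fst (snd p) \<bullet> x + snd (snd p)) \<in> borel_measurable borel"
    by (intro borel_measurable_continuous_onI continuous_intros)
  from measurable_compose[OF this \<sigma>]
  have "(\<lambda>p :: 'd param. fst p * \<sigma> (fst (snd p) \<bullet> x + snd (snd p))) \<in> borel_measurable borel"
    by (intro borel_measurable_times borel_measurable_projections)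
  then show ?thesis by (simp add: case_prod_beta')
qed

lemma neuron_integrable:
  fixes x :: "real ^ 'd::finite"
  assumes \<mu>: "\<mu> \<in> P2"
  shows "integrable \<mu> (\<lambda>(w, a, b). w * \<sigma> (a \<bullet> x + b))"
proof (rule Bochner_Integration.integrable_bound)
  show "integrable \<mu> (\<lambda>p. S * norm p)" using integrable_norm_P2[OF \<mu>] by simp
  show "(\<lambda>(w, a, b). w * \<sigma> (a \<bullet> x + b)) \<in> borel_measurable \<mu>"
    using neuron_measurable measurable_cong_sets[OF P2D(2)[OF \<mu>] refl] by blast
  show "AE p in \<mu>. norm (case p of (w, a, b) \<Rightarrow> w * \<sigma> (a \<bullet> x + b)) \<le> norm (S * norm p)"
    using neuron_bound[of \<sigma> S x, OF bdd] S by (intro AE_I2) (simp add: abs_mult)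
qed

lemma net_bound:
  fixes x :: "real ^ 'd::finite"
  assumes \<mu>: "\<mu> \<in> P2"
  shows "\<bar>net \<sigma> \<mu> x\<bar> \<le> S * sqrt (m2 \<mu>)"
proof -
  have "\<bar>net \<sigma> \<mu> x\<bar> \<le> (\<integral>p. \<bar>case p of (w, a, b) \<Rightarrow> w * \<sigma> (a \<bullet> x + b)\<bar> \<partial>\<mu>)"
    unfolding net_def by (rule integral_abs_bound)
  also have "\<dots> \<le> (\<integral>p. S * norm p \<partial>\<mu>)"
    using neuron_integrable[OF \<mu>, of x] integrable_norm_P2[OF \<mu>]
    by (intro integral_mono neuron_bound bdd integrable_abs) auto
  also have "\<dots> \<le> S * sqrt (m2 \<mu>)"
    using integrable_norm_P2[OF \<mu>] S by (simp add: mult_left_mono)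
  finally show ?thesis .
qed

text \<open>
  The output is an integral of a neuron, so along a coupling it changes by the mean of the
  change of the neuron; the factor \<open>norm p\<close> in the latter becomes the root of the second moment
  by the Cauchy-Schwarz inequality.
\<close>

lemma net_W2_Lipschitz:
  fixes x :: "real ^ 'd::finite"
  assumes \<mu>: "\<mu> \<in> P2" and \<nu>: "\<nu> \<in> P2"
  shows "\<bar>net \<sigma> \<nu> x - net \<sigma> \<mu> x\<bar> \<le> S * (1 + (norm x + 1) * sqrt (m2 \<mu>)) * W2 \<mu> \<nu>"
proof -
  let ?f = "\<lambda>(w, a, b). w * \<sigma> (a \<bullet> x + b)"
  let ?K = "S * (1 + (norm x + 1) * sqrt (m2 \<mu>))"
  have "\<bar>net \<sigma> \<nu> x - net \<sigma> \<mu> x\<bar> \<le> 0 + ?K * W2 \<mu> \<nu>"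
  proof (rule le_mult_W2I)
    show "0 \<le> ?K" using S by (simp add: m2_def)
    fix A assume "W2 \<mu> \<nu> < A"
    then have A0: "0 \<le> A" using W2_nonneg[of \<mu> \<nu>] by linarith
    obtain \<gamma> where \<gamma>: "\<gamma> \<in> couplings \<mu> \<nu>" and A: "transport_cost \<gamma> \<le> ennreal (A\<^sup>2)"
      using near_optimal_coupling[OF \<mu> \<nu> \<open>W2 \<mu> \<nu> < A\<close>] by blast
    note L2 = coupling_L2[OF \<gamma> \<mu> A A0]
    note cpl = integral_coupling[OF \<gamma> neuron_measurable, of x]
    have i1: "integrable \<gamma> (\<lambda>z. ?f (fst z))" and i2: "integrable \<gamma> (\<lambda>z. ?f (snd z))"
      using cpl(3,4) neuron_integrable[OF \<mu>, of x] neuron_integrable[OF \<nu>, of x] by auto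
    have "net \<sigma> \<nu> x - net \<sigma> \<mu> x = (\<integral>z. ?f (snd z) - ?f (fst z) \<partial>\<gamma>)"
      unfolding net_def cpl(1,2)[symmetric] by (rule Bochner_Integration.integral_diff[OF i2 i1, symmetric])
    also have "\<bar>\<dots>\<bar> \<le> (\<integral>z. \<bar>?f (snd z) - ?f (fst z)\<bar> \<partial>\<gamma>)"
      by (rule integral_abs_bound)
    also have "\<dots> \<le> (\<integral>z. S * dist (fst z) (snd z) + S * (norm x + 1) * (norm (fst z) * dist (fst z) (snd z)) \<partial>\<gamma>)"
      using i1 i2 L2(5,7)
      by (intro integral_mono neuron_diff_bound S lip bdd integrable_abs Bochner_Integration.integrable_diff) auto
    also have "\<dots> = S * (\<integral>z. dist (fst z) (snd z) \<partial>\<gamma>)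
        + S * (norm x + 1) * (\<integral>z. norm (fst z) * dist (fst z) (snd z) \<partial>\<gamma>)"
      using L2(5,7) by simp
    also have "\<dots> \<le> S * A + S * (norm x + 1) * (sqrt (m2 \<mu>) * A)"
      using L2(6,8) S by (intro add_mono mult_left_mono) auto
    also have "\<dots> = 0 + ?K * A" by (simp add: algebra_simps)
    finally show "\<bar>net \<sigma> \<nu> x - net \<sigma> \<mu> x\<bar> \<le> 0 + ?K * A" .
  qed
  then show ?thesis by simp
qed

text \<open>
  The tangents of \<open>Lt\<close> at the outputs of \<open>\<mu>\<close> lie below \<open>Lt\<close>, so all constants can be taken at
  \<open>\<mu>\<close>: the slope of \<open>Lt\<close> at the
  output of \<open>\<mu>\<close> grows at most linearly in that output, hence in \<open>\<surd>m\<^sub>2(\<mu>)\<close>, and the Lipschitz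
  constant of the output contributes another such factor.
\<close>

lemma loss_decrease_le_W2:
  fixes x :: "nat \<Rightarrow> real ^ 'd::finite" and y :: "nat \<Rightarrow> real" and Lt :: "real \<Rightarrow> real"
  assumes M: "M \<ge> 1" and Lt: "\<And>r. (Lt has_real_derivative Lt' r) (at r)"
    and convex: "convex_on UNIV Lt"
    and \<beta>: "0 \<le> \<beta>" "\<And>r s. \<bar>Lt' r - Lt' s\<bar> \<le> \<beta> * \<bar>r - s\<bar>"
  obtains B where "0 \<le> B"
    "\<And>\<mu> \<nu>. \<mu> \<in> P2 \<Longrightarrow> \<nu> \<in> P2 \<Longrightarrow>
      loss \<sigma> Lt M x y \<mu> - loss \<sigma> Lt M x y \<nu> \<le> B * (1 + sqrt (m2 \<mu>))\<^sup>2 * W2 \<mu> \<nu>"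
proof -
  define R where "R = (\<Sum>k=1..M. norm (x k))"
  define Y where "Y = (\<Sum>k=1..M. \<bar>y k\<bar>)"
  define B1 where "B1 = \<bar>Lt' 0\<bar> + \<beta> * Y + \<beta> * S"
  define B where "B = B1 * (S * (R + 1))"
  have R: "0 \<le> R" "\<And>k. k \<in> {1..M} \<Longrightarrow> norm (x k) \<le> R"
    unfolding R_def by (auto intro: sum_nonneg member_le_sum)
  have Y: "0 \<le> Y" "\<And>k. k \<in> {1..M} \<Longrightarrow> \<bar>y k\<bar> \<le> Y"
    unfolding Y_def by (auto intro: sum_nonneg member_le_sum)
  have B1: "0 \<le> B1" using \<beta> Y S by (simp add: B1_def)
  show ?thesis
  proof (rule that[of B])
    show "0 \<le> B" using B1 S R by (simp add: B_def)
    fix \<mu> \<nu> :: "'d param measure" assume \<mu>: "\<mu> \<in> P2" and \<nu>: "\<nu> \<in> P2"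
    define s where "s = sqrt (m2 \<mu>)"
    define W where "W = W2 \<mu> \<nu>"
    have s: "0 \<le> s" by (simp add: s_def m2_def)
    have W: "0 \<le> W" by (simp add: W_def W2_nonneg)
    have summand: "Lt (net \<sigma> \<mu> (x k) - y k) - Lt (net \<sigma> \<nu> (x k) - y k) \<le> B * (1 + s)\<^sup>2 * W"
      if k: "k \<in> {1..M}" for k
    proof -
      let ?r = "net \<sigma> \<mu> (x k) - y k" and ?r' = "net \<sigma> \<nu> (x k) - y k"
      have "Lt' ?r * (?r' - ?r) \<le> Lt ?r' - Lt ?r"
        using convex_on_imp_above_tangent[OF convex, of ?r ?r' "Lt' ?r"] Lt by simp
      then have "Lt ?r - Lt ?r' \<le> \<bar>Lt' ?r * (?r' - ?r)\<bar>" by linarith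
      also have "\<dots> = \<bar>Lt' ?r\<bar> * \<bar>?r' - ?r\<bar>" by (rule abs_mult)
      also have "\<dots> \<le> (B1 * (1 + s)) * (S * (R + 1) * (1 + s) * W)"
      proof (rule mult_mono)
        have "\<bar>?r\<bar> \<le> S * s + Y"
          using net_bound[OF \<mu>, of "x k"] Y(2)[OF k] by (simp add: s_def)
        then have "\<beta> * \<bar>?r - 0\<bar> \<le> \<beta> * (S * s + Y)"
          using \<beta>(1) by (intro mult_left_mono) auto
        then have "\<bar>Lt' ?r\<bar> \<le> \<bar>Lt' 0\<bar> + \<beta> * (S * s + Y)"
          using \<beta>(2)[of ?r 0] by linarith
        also have "\<dots> \<le> B1 * (1 + s)"
        proof -
          have "0 \<le> \<bar>Lt' 0\<bar> * s + \<beta> * Y * s + \<beta> * S"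
            using \<beta>(1) Y(1) S s by simp
          then show ?thesis by (simp add: B1_def algebra_simps)
        qed
        finally show "\<bar>Lt' ?r\<bar> \<le> B1 * (1 + s)" .
        have "\<bar>?r' - ?r\<bar> \<le> S * (1 + (norm (x k) + 1) * s) * W"
          using net_W2_Lipschitz[OF \<mu> \<nu>, of "x k"] by (simp add: s_def W_def)
        also have "\<dots> \<le> S * ((R + 1) * (1 + s)) * W"
        proof (intro mult_right_mono mult_left_mono W S)
          have "(norm (x k) + 1) * s \<le> (R + 1) * s"
            using R(2)[OF k] s by (intro mult_right_mono) auto
          then show "1 + (norm (x k) + 1) * s \<le> (R + 1) * (1 + s)"
            using R(1) by (simp add: algebra_simps)
        qed
        finally show "\<bar>?r' - ?r\<bar> \<le> S * (R + 1) * (1 + s) * W" by (simp add: mult.assoc)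
        show "0 \<le> B1 * (1 + s)" using B1 s by simp
      qed simp
      also have "\<dots> = B * (1 + s)\<^sup>2 * W" by (simp add: B_def power2_eq_square algebra_simps)
      finally show ?thesis .
    qed
    have "loss \<sigma> Lt M x y \<mu> - loss \<sigma> Lt M x y \<nu>
      = 1 / real M * (\<Sum>k=1..M. Lt (net \<sigma> \<mu> (x k) - y k) - Lt (net \<sigma> \<nu> (x k) - y k))"
      by (simp add: loss_def sum_subtractf right_diff_distrib diff_divide_distrib)
    also have "\<dots> \<le> 1 / real M * (\<Sum>k=1..M. B * (1 + s)\<^sup>2 * W)"
      by (intro mult_left_mono sum_mono summand) auto
    also have "\<dots> = B * (1 + s)\<^sup>2 * W" using M by simp
    finally show "loss \<sigma> Lt M x y \<mu> - loss \<sigma> Lt M x y \<nu> \<le> B * (1 + sqrt (m2 \<mu>))\<^sup>2 * W2 \<mu> \<nu>"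
      by (simp add: s_def W_def)
  qed
qed

end

section \<open>Proximal optimality of the gradient flow\<close>

lemma linear_minus_quadratic_le:
  fixes A W T :: real
  assumes "T > 0"
  shows "A * W - 1 / (2 * T) * W\<^sup>2 \<le> T * A\<^sup>2 / 2"
proof -
  have "T * A\<^sup>2 / 2 - (A * W - 1 / (2 * T) * W\<^sup>2) = (T * A - W)\<^sup>2 / (2 * T)"
    using assms by (simp add: field_simps power2_eq_square)
  also have "\<dots> \<ge> 0" using assms by simp
  finally show ?thesis by simp
qed

theorem theorem4p16:
  fixes \<sigma> Lt :: "real \<Rightarrow> real"
    and M :: nat
    and x :: "nat \<Rightarrow> real ^ 'd::finite"
    and y :: "nat \<Rightarrow> real"
    and S0 \<beta> A0 A1 :: real
  assumes "M \<ge> 1"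
    and loss_min: "\<exists>\<mu>\<in>P2. loss \<sigma> Lt M x y \<mu> = 0"
      "\<And>\<mu>. \<mu> \<in> P2 \<Longrightarrow> 0 \<le> loss \<sigma> Lt M x y \<mu>"
    and sigma: "S0 \<ge> 0"
      "\<And>z z'. \<bar>\<sigma> z - \<sigma> z'\<bar> \<le> S0 * \<bar>z - z'\<bar>"
      "\<And>z. \<bar>\<sigma> z\<bar> \<le> S0"
      "\<And>z. \<sigma> differentiable (at z)"
      "\<And>z. \<bar>deriv \<sigma> z\<bar> \<le> S0"
    and Lt_C1: "Lt C1_differentiable_on UNIV"
    and Lt_convex: "convex_on UNIV Lt"
    and Lt_smooth: "\<beta> > 0"
      "\<And>r s. \<bar>deriv Lt r - deriv Lt s\<bar> \<le> \<beta> * \<bar>r - s\<bar>"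
    and Lt_min: "\<And>r. 0 \<le> Lt r" "\<exists>r. Lt r = 0"
    and growth: "\<And>\<mu>. \<mu> \<in> P2 \<Longrightarrow> loss \<sigma> Lt M x y \<mu> \<le> A0 + A1 * m2 \<mu>"
  shows "\<exists>C>0. \<forall>\<mu> \<in> P2. \<forall>\<mu>t. gradient_flow \<sigma> Lt M x y \<mu> \<mu>t \<longrightarrow>
    (\<forall>T>0.
      (INF \<nu>\<in>P2. Phi \<sigma> Lt M x y \<mu> T \<nu>) \<le> Phi \<sigma> Lt M x y \<mu> T (\<mu>t T) \<and>
      Phi \<sigma> Lt M x y \<mu> T (\<mu>t T)
        \<le> (INF \<nu>\<in>P2. Phi \<sigma> Lt M x y \<mu> T \<nu>) + C * T * remainder \<sigma> Lt M x y T \<mu>)"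
proof -
  have "(Lt has_real_derivative deriv Lt r) (at r)" for r
    using Lt_C1 unfolding C1_differentiable_on_def
    by (metis DERIV_deriv_iff_field_differentiable UNIV_I field_differentiable_def
        has_real_derivative_iff_has_vector_derivative)
  then obtain B where B: "0 \<le> B" and loss_le: "\<And>\<mu> \<nu>. \<mu> \<in> P2 \<Longrightarrow> \<nu> \<in> P2 \<Longrightarrow>
      loss \<sigma> Lt M x y \<mu> - loss \<sigma> Lt M x y \<nu> \<le> B * (1 + sqrt (m2 \<mu>))\<^sup>2 * W2 \<mu> \<nu>"
    using loss_decrease_le_W2[OF sigma(1-3) \<open>M \<ge> 1\<close> _ Lt_convex less_imp_le[OF Lt_smooth(1)] Lt_smooth(2)]
    by metis
  \<comment> \<open>the summand 1 only secures \<open>C > 0\<close>\<close>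
  define C where "C = 2 * B\<^sup>2 + 1"
  have "(INF \<nu>\<in>P2. Phi \<sigma> Lt M x y \<mu> T \<nu>) \<le> Phi \<sigma> Lt M x y \<mu> T (\<mu>t T) \<and>
      Phi \<sigma> Lt M x y \<mu> T (\<mu>t T)
        \<le> (INF \<nu>\<in>P2. Phi \<sigma> Lt M x y \<mu> T \<nu>) + C * T * remainder \<sigma> Lt M x y T \<mu>"
    if \<mu>: "\<mu> \<in> P2" and flow: "gradient_flow \<sigma> Lt M x y \<mu> \<mu>t" and T: "T > 0"
    for \<mu> :: "'d param measure" and \<mu>t and T :: real
  proof -
    let ?\<Phi> = "Phi \<sigma> Lt M x y \<mu> T" and ?L = "loss \<sigma> Lt M x y"
    let ?r = "C * T * remainder \<sigma> Lt M x y T \<mu>"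
    have AC: "AC2_loc \<mu>t" and \<mu>0: "\<mu>t 0 = \<mu>" using flow by (auto simp: gradient_flow_def)
    have \<mu>T: "\<mu>t T \<in> P2" using AC T by (simp add: AC2_loc_def)
    have slope: "AE t in lborel. t > 0 \<longrightarrow> (\<exists>v. has_metric_derivative \<mu>t v t \<and>
      ((\<lambda>s. ?L (\<mu>t s)) has_real_derivative - (v\<^sup>2)) (at t))"
    proof -
      have "AE t in lborel. t > 0 \<longrightarrow>
          (\<exists>v. has_metric_derivative \<mu>t v t \<and> v\<^sup>2 = (upper_gradient \<sigma> Lt M x y (\<mu>t t))\<^sup>2 \<and>
           ((\<lambda>s. ?L (\<mu>t s)) has_real_derivative - (v\<^sup>2)) (at t))"
        using flow unfolding gradient_flow_def by blast
      then show ?thesis by (rule AE_mp) (rule AE_I2, blast)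
    qed
    have "?L (\<mu>t T) + (W2 \<mu> (\<mu>t T))\<^sup>2 / T \<le> ?L \<mu>"
      using maximal_slope_dissipation[OF AC loss_le B slope T] by (simp add: \<mu>0)
    moreover have "1 / (2 * T) * (W2 \<mu> (\<mu>t T))\<^sup>2 \<le> (W2 \<mu> (\<mu>t T))\<^sup>2 / T"
      using T by (simp add: field_simps)
    ultimately have upper: "?\<Phi> (\<mu>t T) \<le> ?L \<mu>"
      unfolding Phi_def by linarith
    have lower: "?L \<mu> - ?r \<le> ?\<Phi> \<nu>" if \<nu>: "\<nu> \<in> P2" for \<nu>
    proof -
      let ?s = "sqrt (m2 \<mu>)"
      let ?m = "1 + m2 \<mu>"
      have m2: "0 \<le> m2 \<mu>" by (simp add: m2_def)
      have "(1 + ?s)\<^sup>2 \<le> 2 * ?m"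
        using m2 zero_le_power2[of "1 - ?s"] by (simp add: power2_sum power2_diff)
      then have "B * (1 + ?s)\<^sup>2 \<le> 2 * B * ?m"
        using mult_left_mono[OF _ B, of "(1 + ?s)\<^sup>2" "2 * ?m"] by (simp only: mult.assoc mult.left_commute)
      then have "(B * (1 + ?s)\<^sup>2)\<^sup>2 \<le> (2 * B * ?m)\<^sup>2"
        using B by (intro power_mono) auto
      then have "T * (B * (1 + ?s)\<^sup>2)\<^sup>2 / 2 \<le> T * (2 * B * ?m)\<^sup>2 / 2"
        using T by simp
      also have "\<dots> = 2 * B\<^sup>2 * T * ?m\<^sup>2" by (simp add: power2_eq_square)
      also have "\<dots> \<le> C * T * ?m\<^sup>2"
        using T by (intro mult_right_mono) (auto simp: C_def)
      also have "\<dots> \<le> ?r"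
        unfolding remainder_def using T m2 loss_min(2)[OF \<mu>]
        by (intro mult_left_mono power_mono) (auto simp: C_def)
      finally have "T * (B * (1 + ?s)\<^sup>2)\<^sup>2 / 2 \<le> ?r" .
      then show ?thesis
        using loss_le[OF \<mu> \<nu>] linear_minus_quadratic_le[OF T, of "B * (1 + ?s)\<^sup>2" "W2 \<mu> \<nu>"]
        unfolding Phi_def by linarith
    qed
    have "bdd_below (?\<Phi> ` P2)" using lower by (intro bdd_belowI2)
    then have "(INF \<nu>\<in>P2. ?\<Phi> \<nu>) \<le> ?\<Phi> (\<mu>t T)"
      using \<mu>T by (rule cINF_lower)
    moreover have "?L \<mu> - ?r \<le> (INF \<nu>\<in>P2. ?\<Phi> \<nu>)"
      using \<mu> lower by (intro cINF_greatest) auto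
    ultimately show ?thesis using upper by linarith
  qed
  moreover have "C > 0" by (simp add: C_def add_nonneg_pos)
  ultimately show ?thesis by blast
qed

end
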